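(* There exist a sequence $\{Q_n\}_{n\in\mathbb{N}}$ of open bounded simply connected subsets of $\mathbb{R}^2$ and a constant $C>0$ such that \[ 0<r_{Q_n}\le C\qquad\text{for every } n\in\mathbb{N}, \] and \[ \lim_{n\to\infty}\lambda_1^s(Q_n)=0\qquad\text{for every } 0<s\le\frac12. \]
   Context: For an open set $\Omega\subset\mathbb{R}^N$, $C^\infty_0(\Omega)$ is the space of smooth functions with compact support in $\Omega$ (extended by zero to $\mathbb{R}^N$). For $0<s<1$, \[ [u]_{W^{s,2}(\mathbb{R}^N)}=\left(\iint_{\mathbb{R}^N\times\mathbb{R}^N}\frac{|u(x)-u(y)|^2}{|x-y|^{N+2s}}\,dx\,dy\right)^{1/2}, \] $W^{s,2}(\mathbb{R}^N)=\{u\in L^2(\mathbb{R}^N): [u]_{W^{s,2}(\mathbb{R}^N)}<+\infty\}$ with norm $\|u\|_{L^2(\mathbb{R}^N)}+[u]_{W^{s,2}(\mathbb{R}^N)}$, and $\widetilde W^{s,2}_0(\Omega)$ is the closure of $C^\infty_0(\Omega)$ in $W^{s,2}(\mathbb{R}^N)$. Set \[ \lambda_1^s(\Omega)=\inf_{u\in\widetilde W^{s,2}_0(\Omega)\setminus\{0\}}\frac{[u]^2_{W^{s,2}(\mathbb{R}^N)}}{\|u\|^2_{L^2(\Omega)}}. \] The inradius is $r_\Omega=\sup\{\rho>0:\exists\,x\in\Omega \text{ such that } B_\rho(x)\subset\Omega\}$, where $B_\rho(x)$ is the open ball of radius $\rho$ and center $x$. Simply connected means nonempty, connected, and with every closed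 loop null-homotopic. *)

theory Defs
  imports "HOL-Analysis.Analysis"
begin

fun Ck :: "nat \<Rightarrow> ('a::euclidean_space \<Rightarrow> real) \<Rightarrow> bool" where
  "Ck 0 f \<longleftrightarrow> continuous_on UNIV f"
| "Ck (Suc k) f \<longleftrightarrow> f differentiable_on UNIV \<and>
     (\<forall>b\<in>Basis. Ck k (\<lambda>x. frechet_derivative f (at x) b))"

text \<open>A function in the space below is smooth on the whole space and already extended by zero:
  for an open \<open>\<Omega>\<close>, this is the same as being smooth in \<open>\<Omega>\<close> with compact support in \<open>\<Omega>\<close>.\<close>

definition test_functions :: "'a::euclidean_space set \<Rightarrow> ('a \<Rightarrow> real) set" where
  "test_functions \<Omega> = {\<phi>. (\<forall>k. Ck k \<phi>) \<and>
     compact (closure {x. \<phi> x \<noteq> 0}) \<and> closure {x. \<phi> x \<noteq> 0} \<subseteq> \<Omega>}"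

text \<open>On the diagonal the integrand is \<open>0 / 0 = 0\<close>; the diagonal is a null set.\<close>

definition gagliardo_energy :: "real \<Rightarrow> ('a::euclidean_space \<Rightarrow> real) \<Rightarrow> ennreal" where
  "gagliardo_energy s u =
     (\<integral>\<^sup>+ (x, y). ennreal (\<bar>u x - u y\<bar>\<^sup>2 / norm (x - y) powr (real DIM('a) + 2 * s))
        \<partial>(lborel \<Otimes>\<^sub>M lborel))"

text \<open>The next definition is meaningful only when the energy is finite, since
  \<^term>\<open>enn2real\<close> sends infinity to \<open>0\<close>.\<close>

definition gagliardo_seminorm :: "real \<Rightarrow> ('a::euclidean_space \<Rightarrow> real) \<Rightarrow> real" where
  "gagliardo_seminorm s u = sqrt (enn2real (gagliardo_energy s u))"

definition L2_norm_on :: "'a::euclidean_space set \<Rightarrow> ('a \<Rightarrow> real) \<Rightarrow> real" where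
  "L2_norm_on \<Omega> u = sqrt (LINT x:\<Omega>|lborel. \<bar>u x\<bar>\<^sup>2)"

text \<open>Elements of \<open>L\<^sup>2\<close> are represented by Borel functions, without passing to the quotient by
  almost everywhere equality; every class of Lebesgue measurable functions has a Borel
  representative.\<close>

definition Ws2 :: "real \<Rightarrow> ('a::euclidean_space \<Rightarrow> real) set" where
  "Ws2 s = {u \<in> borel_measurable borel.
     integrable lborel (\<lambda>x. \<bar>u x\<bar>\<^sup>2) \<and> gagliardo_energy s u < \<infinity>}"

definition Ws2_norm :: "real \<Rightarrow> ('a::euclidean_space \<Rightarrow> real) \<Rightarrow> real" where
  "Ws2_norm s u = L2_norm_on UNIV u + gagliardo_seminorm s u"

definition Ws2_0 :: "real \<Rightarrow> 'a::euclidean_space set \<Rightarrow> ('a \<Rightarrow> real) set" where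
  "Ws2_0 s \<Omega> = {u \<in> Ws2 s.
     \<forall>\<epsilon>>0. \<exists>\<phi>\<in>test_functions \<Omega>. Ws2_norm s (\<lambda>x. u x - \<phi> x) < \<epsilon>}"

text \<open>As functions stand for their almost everywhere classes, \<open>u \<noteq> 0\<close> means that \<open>u\<close> is not almost
  everywhere zero. The infimum is taken in \<open>[0, \<infinity>]\<close>.\<close>

definition lambda1 :: "real \<Rightarrow> 'a::euclidean_space set \<Rightarrow> ennreal" where
  "lambda1 s \<Omega> = (INF u \<in> {u \<in> Ws2_0 s \<Omega>. \<not> (AE x in lborel. u x = 0)}.
     ennreal ((gagliardo_seminorm s u)\<^sup>2 / (L2_norm_on \<Omega> u)\<^sup>2))"

text \<open>The supremum is taken in \<open>[0, \<infinity>]\<close>.\<close>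

definition inradius :: "'a::euclidean_space set \<Rightarrow> ennreal" where
  "inradius \<Omega> = (SUP \<rho> \<in> {\<rho>::real. \<rho> > 0 \<and> (\<exists>x\<in>\<Omega>. ball x \<rho> \<subseteq> \<Omega>)}. ennreal \<rho>)"

end

theory Submission imports Defs begin

text \<open>
  The domains are combs: from the square \<open>(0, m) \<times> (0, m)\<close> remove the vertical slits
  \<open>{i} \<times> [1, m)\<close> for the integers \<open>i\<close> strictly between \<open>0\<close> and \<open>m\<close>. A ball of radius greater than \<open>2\<close> inside the
  square meets a slit, so the inradius stays bounded, and pushing every point vertically to height
  \<open>1 / 2\<close> deforms a comb to a segment, so it is contractible. For \<open>s \<le> 1 / 2\<close>, on the other hand,
  the slits have zero capacity and are invisible to the energy. The square itself has first
  eigenvalue of order \<open>m\<close> to the power \<open>- 2 s\<close>, and so the combs do, up to a constant.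

  To make this quantitative, take test functions \<open>a(x) a(y)\<close>, with \<open>a\<close> smooth on the line, zero near
  the integers and close to a bump spread over \<open>[0, m]\<close>. Integrating out one difference variable
  with the Cauchy density, \<open>\<integral> dt / (A\<^sup>2 + t\<^sup>2) = \<pi> / A\<close>, bounds the planar energy of the
  product by the one-dimensional energy of \<open>a\<close> of the same order \<open>s\<close>
  (\<open>gagliardo_energy_tensor_le\<close>). Splitting the double integral at distance \<open>m\<close> bounds that energy
  in turn by the one of order \<open>1 / 2\<close> and the \<open>L\<^sup>2\<close> norm (\<open>half_energy_interpolation\<close>), so
  one profile \<open>a\<close> serves every \<open>s \<le> 1 / 2\<close>. It remains to keep the energy of order \<open>1 / 2\<close> of \<open>a\<close> bounded
  as \<open>m\<close> grows, while its squared \<open>L\<^sup>2\<close> norm grows like \<open>m\<close> (\<open>exists_half_energy_test_profile\<close>).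

  The order \<open>1 / 2\<close> is critical on the line: its energy is invariant under dilations and translations
  (\<open>half_energy_affine_invariant\<close>). The spread bump therefore has bounded energy. The same invariance
  gives points zero capacity: a bump that is concentrated enough at \<open>0\<close> hardly interacts with a given
  function, because the pairs of points at which it lives shrink to a null set. Adding \<open>K\<close>
  successively more concentrated bumps gives a function with energy \<open>O(K)\<close> and value \<open>K\<close> near \<open>0\<close>;
  divided by \<open>K\<close>, it has energy \<open>O(1 / K)\<close> and value \<open>1\<close> near \<open>0\<close>
  (\<open>exists_cutoff_small_half_energy\<close>). This replaces the usual logarithmic cutoff and is smooth by
  construction.
\<close>

section \<open>Smooth functions and a cutoff on the line\<close>

lemma Ck_SucI:
  assumes "\<And>x. (f has_derivative f' x) (at x)" and "\<And>b. b \<in> Basis \<Longrightarrow> Ck k (\<lambda>x. f' x b)"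
  shows "Ck (Suc k) f"
proof -
  have "frechet_derivative f (at x) = f' x" for x
    using assms(1) frechet_derivative_at by metis
  moreover have "f differentiable_on UNIV"
    using assms(1) by (meson differentiable_at_imp_differentiable_on differentiable_def)
  ultimately show ?thesis using assms(2) by simp
qed

lemma Ck_SucD:
  assumes "Ck (Suc k) f"
  shows "\<exists>f'. (\<forall>x. (f has_derivative f' x) (at x)) \<and> (\<forall>b\<in>Basis. Ck k (\<lambda>x. f' x b))"
proof (intro exI conjI allI)
  show "(f has_derivative frechet_derivative f (at x)) (at x)" for x
    using assms by (auto simp: differentiable_on_def frechet_derivative_works)
qed (use assms in auto)

lemma Ck_Suc_imp_Ck: "Ck (Suc k) f \<Longrightarrow> Ck k f"
proof (induction k arbitrary: f)
  case 0
  then show ?case by (auto intro: differentiable_imp_continuous_on)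
next
  case (Suc k)
  obtain f' where f': "\<And>x. (f has_derivative f' x) (at x)"
    "\<And>b. b \<in> Basis \<Longrightarrow> Ck (Suc k) (\<lambda>x. f' x b)" using Ck_SucD[OF Suc.prems] by blast
  show ?case by (rule Ck_SucI[OF f'(1)]) (rule Suc.IH[OF f'(2)])
qed

lemma Ck_imp_continuous_on: "Ck k f \<Longrightarrow> continuous_on UNIV f"
  by (induction k) (auto dest: Ck_Suc_imp_Ck differentiable_imp_continuous_on)

lemma Ck_imp_borel_measurable: "Ck k f \<Longrightarrow> f \<in> borel_measurable borel"
  using Ck_imp_continuous_on borel_measurable_continuous_onI by blast

lemma Ck_const: "Ck k (\<lambda>x. c)"
proof (induction k arbitrary: c)
  case (Suc k)
  show ?case by (rule Ck_SucI[OF has_derivative_const]) (rule Suc.IH)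
qed simp

lemma Ck_add: "Ck k f \<Longrightarrow> Ck k g \<Longrightarrow> Ck k (\<lambda>x. f x + g x)"
proof (induction k arbitrary: f g)
  case 0
  then show ?case by (simp add: continuous_on_mult continuous_on_add)
next
  case (Suc k)
  obtain f' where f': "\<And>x. (f has_derivative f' x) (at x)" "\<And>b. b \<in> Basis \<Longrightarrow> Ck k (\<lambda>x. f' x b)"
    using Ck_SucD[OF Suc.prems(1)] by blast
  obtain g' where g': "\<And>x. (g has_derivative g' x) (at x)" "\<And>b. b \<in> Basis \<Longrightarrow> Ck k (\<lambda>x. g' x b)"
    using Ck_SucD[OF Suc.prems(2)] by blast
  show ?case
    by (rule Ck_SucI[OF has_derivative_add[OF f'(1) g'(1)]]) (intro Suc.IH f' g')
qed

lemma Ck_mult: "Ck k f \<Longrightarrow> Ck k g \<Longrightarrow> Ck k (\<lambda>x. f x * g x)"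
proof (induction k arbitrary: f g)
  case 0
  then show ?case by (simp add: continuous_on_mult continuous_on_add)
next
  case (Suc k)
  obtain f' where f': "\<And>x. (f has_derivative f' x) (at x)" "\<And>b. b \<in> Basis \<Longrightarrow> Ck k (\<lambda>x. f' x b)"
    using Ck_SucD[OF Suc.prems(1)] by blast
  obtain g' where g': "\<And>x. (g has_derivative g' x) (at x)" "\<And>b. b \<in> Basis \<Longrightarrow> Ck k (\<lambda>x. g' x b)"
    using Ck_SucD[OF Suc.prems(2)] by blast
  show ?case
    by (rule Ck_SucI[OF has_derivative_mult[OF f'(1) g'(1)]])
      (intro Ck_add Suc.IH f' g' Suc.prems[THEN Ck_Suc_imp_Ck])
qed

lemma Ck_diff: "Ck k f \<Longrightarrow> Ck k g \<Longrightarrow> Ck k (\<lambda>x. f x - g x)"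
  using Ck_add[of k f "\<lambda>x. -1 * g x"] Ck_mult[OF Ck_const[of k "-1"], of g] by simp

lemma Ck_inverse:
  assumes "Ck k f" and nz: "\<And>x. f x \<noteq> 0"
  shows "Ck k (\<lambda>x. inverse (f x))"
  using assms(1)
proof (induction k)
  case 0
  then show ?case using nz by (simp add: continuous_on_inverse)
next
  case (Suc k)
  obtain f' where f': "\<And>x. (f has_derivative f' x) (at x)" "\<And>b. b \<in> Basis \<Longrightarrow> Ck k (\<lambda>x. f' x b)"
    using Ck_SucD[OF Suc.prems(1)] by blast
  have "Ck k (\<lambda>x. inverse (f x))" by (rule Suc.IH[OF Ck_Suc_imp_Ck[OF Suc.prems]])
  then have *: "Ck k (\<lambda>x. -1 * (inverse (f x) * f' x b * inverse (f x)))" if "b \<in> Basis" for b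
    using that f'(2) by (intro Ck_mult Ck_const)
  show ?case
    by (rule Ck_SucI[OF Deriv.has_derivative_inverse[OF nz f'(1)]]) (use * in simp)
qed

lemma has_derivative_real_linear:
  fixes D :: "real \<Rightarrow> real"
  assumes "(f has_derivative D) F"
  shows "D h = h * D 1"
  using linear_cmul[OF has_derivative_linear[OF assms], of h 1] by simp

text \<open>The inner map has the same derivative at every point, that is, it is affine. Hence derivatives of
  the composition are compositions of the same kind, up to a constant factor, and induction on the
  order of differentiability applies.\<close>

lemma Ck_compose_affine:
  fixes f :: "real \<Rightarrow> real" and L :: "'a::euclidean_space \<Rightarrow> real"
  assumes "Ck k f" and L: "\<And>x. (L has_derivative L') (at x)"
  shows "Ck k (\<lambda>x. f (L x))"
  using assms(1)
proof (induction k arbitrary: f)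
  case 0
  have "continuous_on UNIV L"
    using L by (meson UNIV_I continuous_at_imp_continuous_on has_derivative_continuous)
  with 0 show ?case by (auto intro: continuous_on_compose2)
next
  case (Suc k)
  obtain f' where f': "\<And>x. (f has_derivative f' x) (at x)" "\<And>b. b \<in> Basis \<Longrightarrow> Ck k (\<lambda>x. f' x b)"
    using Ck_SucD[OF Suc.prems(1)] by blast
  have lin: "f' x h = h * f' x 1" for x h
    using f'(1) by (rule has_derivative_real_linear)
  have "Ck k (\<lambda>x. L' b * f' (L x) 1)" for b
    by (intro Ck_mult Ck_const Suc.IH f') simp
  then have "Ck k (\<lambda>x. f' (L x) (L' b))" for b
    by (subst lin)
  then show ?case
    by (rule Ck_SucI[OF has_derivative_compose[OF L f'(1)]])
qed

text \<open>The powers of \<open>1 / t\<close> make the family closed under differentiation, up to linear combinations.\<close>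

definition flat_exp :: "nat \<Rightarrow> real \<Rightarrow> real" where
  "flat_exp j t = (if t > 0 then (1 / t) ^ j * exp (- 1 / t) else 0)"

text \<open>A quadratic bound at \<open>0\<close> makes the derivative there vanish; it comes from the term of degree
  \<open>j + 2\<close> in the exponential series at \<open>1 / t\<close>.\<close>

lemma flat_exp_le_square: "\<bar>flat_exp j t\<bar> \<le> fact (j + 2) * t\<^sup>2"
proof (cases "t > 0")
  case True
  have "(1 / t) ^ (j + 2) / fact (j + 2) \<le> exp (1 / t)"
    using sum_le_suminf[OF summable_exp, of "{j + 2}" "1 / t"] True
    by (simp add: exp_def divide_inverse mult.commute)
  then have le: "(1 / t) ^ (j + 2) \<le> fact (j + 2) * exp (1 / t)"
    by (simp only: divide_le_eq fact_gt_zero if_True mult.commute)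
  have "(1 / t) ^ j * exp (- 1 / t) = (1 / t) ^ (j + 2) * (t\<^sup>2 * exp (- (1 / t)))"
    using True by (simp add: power_add power_divide power2_eq_square)
  also have "\<dots> \<le> fact (j + 2) * exp (1 / t) * (t\<^sup>2 * exp (- (1 / t)))"
    by (rule mult_right_mono[OF le]) simp
  also have "\<dots> = fact (j + 2) * t\<^sup>2 * (exp (1 / t) * exp (- (1 / t)))"
    by (simp only: mult_ac)
  also have "exp (1 / t) * exp (- (1 / t)) = 1" by (rule exp_minus_inverse)
  finally show ?thesis using True by (simp add: flat_exp_def abs_mult)
qed (simp add: flat_exp_def)

lemma DERIV_flat_exp:
  "(flat_exp j has_real_derivative flat_exp (j + 2) t - real j * flat_exp (j + 1) t) (at t)"
proof (cases t "0::real" rule: linorder_cases)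
  case less
  have "((\<lambda>_. 0) has_real_derivative flat_exp (j + 2) t - real j * flat_exp (j + 1) t) (at t)"
    using less by (auto simp: flat_exp_def)
  moreover have "eventually (\<lambda>x. 0 = flat_exp j x) (nhds t)"
    by (rule eventually_mono[OF eventually_nhds_in_open[of "{..<0}"]]) (use less in \<open>auto simp: flat_exp_def\<close>)
  ultimately show ?thesis using less DERIV_cong_ev[of t t "\<lambda>_. 0" "flat_exp j"] by blast
next
  case equal
  have "((\<lambda>h. flat_exp j h / h) \<longlongrightarrow> 0) (at 0)"
  proof (rule Lim_null_comparison)
    show "\<forall>\<^sub>F h in at 0. norm (flat_exp j h / h) \<le> fact (j + 2) * \<bar>h\<bar>"
      using flat_exp_le_square[of j]
      by (auto simp: eventually_at_filter divide_le_eq power2_eq_square abs_mult mult.assoc)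
    show "((\<lambda>h. fact (j + 2) * \<bar>h\<bar>) \<longlongrightarrow> (0::real)) (at 0)" by (auto intro!: tendsto_eq_intros)
  qed
  then show ?thesis using equal by (simp add: DERIV_def flat_exp_def)
next
  case greater
  have u: "((\<lambda>t. 1 / t) has_real_derivative - ((1 / t)\<^sup>2)) (at t)"
    using greater by (auto intro!: derivative_eq_intros simp: power2_eq_square)
  have e: "((\<lambda>t. exp (- 1 / t)) has_real_derivative exp (- 1 / t) * (1 / t)\<^sup>2) (at t)"
    using DERIV_fun_exp[OF DERIV_minus[OF u]] by simp
  have "real j * (- ((1 / t)\<^sup>2) * (1 / t) ^ (j - Suc 0)) = - real j * (1 / t) ^ (j + 1)"
    by (cases j) (simp_all only: power2_eq_square diff_Suc_1 power_Suc
      Suc_eq_plus1[symmetric] mult_ac mult_minus_left mult_minus_right of_nat_0 mult_zero_left, simp_all)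
  then have "((\<lambda>t. (1 / t) ^ j * exp (- 1 / t)) has_real_derivative
      flat_exp (j + 2) t - real j * flat_exp (j + 1) t) (at t)"
    using DERIV_mult[OF DERIV_power[OF u, of j] e] greater
    by (simp add: flat_exp_def power_add power2_eq_square mult_ac)
  moreover have "eventually (\<lambda>x. (1 / x) ^ j * exp (- 1 / x) = flat_exp j x) (nhds t)"
    by (rule eventually_mono[OF eventually_nhds_in_open[of "{0<..}"]]) (use greater in \<open>auto simp: flat_exp_def\<close>)
  ultimately show ?thesis
    using DERIV_cong_ev[of t t "\<lambda>t. (1 / t) ^ j * exp (- 1 / t)" "flat_exp j"] by blast
qed

lemma Ck_flat_exp: "Ck k (flat_exp j)"
proof (induction k arbitrary: j)
  case 0
  show ?case using DERIV_flat_exp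
    by (auto intro!: continuous_at_imp_continuous_on DERIV_isCont)
next
  case (Suc k)
  show ?case
    by (rule Ck_SucI[OF DERIV_flat_exp[unfolded has_field_derivative_def]])
      (use Suc in \<open>auto intro!: Ck_diff Ck_mult Ck_const\<close>)
qed

definition smooth_step :: "real \<Rightarrow> real" where
  "smooth_step t = flat_exp 0 t * inverse (flat_exp 0 t + flat_exp 0 (1 - t))"

lemma Ck_smooth_step: "Ck k smooth_step"
proof -
  have "Ck k (\<lambda>t. flat_exp 0 t * inverse (flat_exp 0 t + flat_exp 0 (1 - t)))"
  proof (intro Ck_mult Ck_inverse Ck_add Ck_flat_exp)
    show "Ck k (\<lambda>x. flat_exp 0 (1 - x))"
      by (rule Ck_compose_affine[OF Ck_flat_exp]) (auto intro!: derivative_eq_intros)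
    show "flat_exp 0 x + flat_exp 0 (1 - x) \<noteq> 0" for x
      by (smt (verit) exp_gt_zero flat_exp_def mult_cancel_right1 power_0)
  qed
  then show ?thesis by (simp add: smooth_step_def[abs_def])
qed

definition bump :: "real \<Rightarrow> real" where
  "bump t = smooth_step (2 + t) * smooth_step (2 - t)"

lemma Ck_bump: "Ck k bump"
  unfolding bump_def[abs_def]
  by (intro Ck_mult Ck_compose_affine[OF Ck_smooth_step]) (auto intro!: derivative_eq_intros)

lemma smooth_step_bounds: "0 \<le> smooth_step t" "smooth_step t \<le> 1"
proof -
  have "a * inverse (a + b) \<in> {0..1}" if "a \<ge> 0" "b \<ge> 0" for a b :: real
    using that by (auto simp: divide_le_eq simp flip: divide_inverse)
  then have "smooth_step t \<in> {0..1}" by (simp add: smooth_step_def flat_exp_def)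
  then show "0 \<le> smooth_step t" "smooth_step t \<le> 1" by auto
qed

lemma bump_bounds: "0 \<le> bump t" "bump t \<le> 1"
  by (auto simp: bump_def smooth_step_bounds mult_le_one)

lemma bump_eq_1: "\<bar>t\<bar> \<le> 1 \<Longrightarrow> bump t = 1"
  by (auto simp: bump_def smooth_step_def flat_exp_def)

lemma bump_eq_0: "\<bar>t\<bar> \<ge> 2 \<Longrightarrow> bump t = 0"
  by (auto simp: bump_def smooth_step_def flat_exp_def)

text \<open>The derivative is bounded on the compact interval \<open>[- 2, 2]\<close>, and clipping the argument to this
  interval does not change the value.\<close>

lemma bump_lipschitz: "\<exists>L>0. \<forall>x y. \<bar>bump x - bump y\<bar> \<le> L * \<bar>x - y\<bar>"
proof -
  obtain f' where f': "\<And>x. (bump has_derivative f' x) (at x)"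
    "\<And>b. b \<in> Basis \<Longrightarrow> Ck 0 (\<lambda>x. f' x b)" using Ck_SucD[OF Ck_bump] by blast
  have der: "(bump has_real_derivative f' x 1) (at x)" for x
    by (rule has_derivative_imp_has_field_derivative[OF f'(1)])
      (rule has_derivative_real_linear[OF f'(1), symmetric])
  have "continuous_on {-2..2} (\<lambda>x. f' x 1)" using f'(2)[of 1] continuous_on_subset by auto
  then have "bounded ((\<lambda>x. f' x 1) ` {-2..2})"
    by (intro compact_imp_bounded compact_continuous_image) auto
  then obtain B where B: "B > 0" "\<And>x. x \<in> {-2..2} \<Longrightarrow> \<bar>f' x 1\<bar> \<le> B" by (auto simp: bounded_pos)
  \<comment> \<open>the values at the end points are zero, like all values outside the interval\<close>
  have clip: "bump x = bump (max (-2) (min 2 x))" for x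
    using bump_eq_0[of x] bump_eq_0[of 2] bump_eq_0[of "-2"] by (auto simp: max_def min_def)
  have "\<bar>bump x - bump y\<bar> \<le> B * \<bar>x - y\<bar>" for x y
  proof -
    have "norm (bump (max (-2) (min 2 x)) - bump (max (-2) (min 2 y)))
        \<le> B * norm (max (-2) (min 2 x) - max (-2) (min 2 y))"
      by (rule field_differentiable_bound[of "{-2..2}" bump "\<lambda>x. f' x 1"])
        (use B der in \<open>auto intro: has_field_derivative_at_within\<close>)
    also have "\<dots> \<le> B * \<bar>x - y\<bar>" using B by (auto simp: max_def min_def)
    finally show ?thesis by (simp flip: clip)
  qed
  with B show ?thesis by blast
qed

section \<open>Gagliardo energies on the line\<close>

lemma square_add_le: "(p + q)\<^sup>2 \<le> 2 * p\<^sup>2 + 2 * (q::real)\<^sup>2"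
  using zero_le_power2[of "p - q"] by (simp add: power2_eq_square algebra_simps)

lemma gagliardo_energy_iterated:
  fixes u :: "'a::euclidean_space \<Rightarrow> real"
  assumes [measurable]: "u \<in> borel_measurable borel"
  shows "gagliardo_energy s u = (\<integral>\<^sup>+ x. \<integral>\<^sup>+ y. ennreal ((u x - u y)\<^sup>2 / norm (x - y) powr (real DIM('a) + 2 * s)) \<partial>lborel \<partial>lborel)"
  unfolding gagliardo_energy_def
  by (subst lborel.nn_integral_fst[symmetric]) simp_all

lemma ennreal_double_add:
  "a \<ge> 0 \<Longrightarrow> b \<ge> 0 \<Longrightarrow> ennreal (2 * a + 2 * b) = 2 * ennreal a + 2 * ennreal b"
  by (simp add: ennreal_mult)

lemma gagliardo_energy_le_add:
  fixes u v w :: "'a::euclidean_space \<Rightarrow> real"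
  assumes [measurable]: "u \<in> borel_measurable borel" "v \<in> borel_measurable borel"
    and le: "\<And>x y. (w x - w y)\<^sup>2 \<le> 2 * (u x - u y)\<^sup>2 + 2 * (v x - v y)\<^sup>2"
  shows "gagliardo_energy s w \<le> 2 * gagliardo_energy s u + 2 * gagliardo_energy s v"
proof -
  have "ennreal ((w x - w y)\<^sup>2 / d) \<le> 2 * ennreal ((u x - u y)\<^sup>2 / d) + 2 * ennreal ((v x - v y)\<^sup>2 / d)"
    if "d \<ge> 0" for x y d
  proof -
    have "(w x - w y)\<^sup>2 / d \<le> 2 * ((u x - u y)\<^sup>2 / d) + 2 * ((v x - v y)\<^sup>2 / d)"
      using divide_right_mono[OF le[of x y] that] by (simp add: add_divide_distrib)
    then have "ennreal ((w x - w y)\<^sup>2 / d) \<le> ennreal (2 * ((u x - u y)\<^sup>2 / d) + 2 * ((v x - v y)\<^sup>2 / d))"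
      by (rule ennreal_leI)
    also have "\<dots> = 2 * ennreal ((u x - u y)\<^sup>2 / d) + 2 * ennreal ((v x - v y)\<^sup>2 / d)"
      by (rule ennreal_double_add) (use that in auto)
    finally show ?thesis .
  qed
  then have "gagliardo_energy s w \<le> (\<integral>\<^sup>+ (x, y).
       2 * ennreal (\<bar>u x - u y\<bar>\<^sup>2 / norm (x - y) powr (real DIM('a) + 2 * s)) +
       2 * ennreal (\<bar>v x - v y\<bar>\<^sup>2 / norm (x - y) powr (real DIM('a) + 2 * s)) \<partial>(lborel \<Otimes>\<^sub>M lborel))"
    unfolding gagliardo_energy_def by (intro nn_integral_mono) auto
  also have "\<dots> = 2 * gagliardo_energy s u + 2 * gagliardo_energy s v"
    unfolding gagliardo_energy_def case_prod_beta
    by (simp add: nn_integral_add nn_integral_cmult)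
  finally show ?thesis .
qed

text \<open>The increment of a product splits as \<open>(f x - f y) g x + f y (g x - g y)\<close>.\<close>

lemma gagliardo_energy_mult_le:
  assumes [measurable]: "f \<in> borel_measurable borel" "g \<in> borel_measurable borel"
    and f: "\<And>x. \<bar>f x\<bar> \<le> 1" and g: "\<And>x. \<bar>g x\<bar> \<le> 1"
  shows "gagliardo_energy s (\<lambda>x. f x * g x) \<le> 2 * gagliardo_energy s f + 2 * gagliardo_energy s g"
proof (rule gagliardo_energy_le_add)
  fix x y
  have "(f x * g x - f y * g y)\<^sup>2 = ((f x - f y) * g x + f y * (g x - g y))\<^sup>2"
    by (simp add: algebra_simps)
  also have "\<dots> \<le> 2 * ((f x - f y) * g x)\<^sup>2 + 2 * (f y * (g x - g y))\<^sup>2"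
    by (rule square_add_le)
  also have "((f x - f y) * g x)\<^sup>2 \<le> (f x - f y)\<^sup>2 * 1"
    unfolding power_mult_distrib using g[of x] by (intro mult_left_mono) (auto simp: abs_square_le_1)
  also have "(f y * (g x - g y))\<^sup>2 \<le> 1 * (g x - g y)\<^sup>2"
    unfolding power_mult_distrib using f[of y] by (intro mult_right_mono) (auto simp: abs_square_le_1)
  finally show "(f x * g x - f y * g y)\<^sup>2 \<le> 2 * (f x - f y)\<^sup>2 + 2 * (g x - g y)\<^sup>2" by simp
qed auto

lemma gagliardo_energy_affine_values:
  fixes u :: "'a::euclidean_space \<Rightarrow> real"
  assumes [measurable]: "u \<in> borel_measurable borel"
  shows "gagliardo_energy s (\<lambda>x. c - d * u x) = ennreal (d\<^sup>2) * gagliardo_energy s u"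
proof -
  have "\<bar>(c - d * u x) - (c - d * u y)\<bar>\<^sup>2 = d\<^sup>2 * \<bar>u x - u y\<bar>\<^sup>2" for x y
    by (simp add: power2_eq_square algebra_simps)
  then show ?thesis
    unfolding gagliardo_energy_def case_prod_beta
    by (subst nn_integral_cmult[symmetric]) (auto simp: ennreal_mult'[symmetric])
qed

lemma gagliardo_energy_const: "gagliardo_energy s (\<lambda>_. c) = 0"
  unfolding gagliardo_energy_def case_prod_beta by simp

text \<open>A dilation by \<open>c\<close> contributes the factor \<open>c\<^sup>2\<close> through the kernel \<open>1 / |x - y|\<^sup>2\<close>, which
  cancels the Jacobian of the two integrations.\<close>

lemma half_energy_affine_invariant:
  fixes f :: "real \<Rightarrow> real"
  assumes [measurable]: "f \<in> borel_measurable borel" and c: "c > 0"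
  shows "gagliardo_energy (1/2) (\<lambda>x. f (d + c * x)) = gagliardo_energy (1/2) f"
proof -
  define G where "G x y = ennreal ((f x - f y)\<^sup>2 / (x - y)\<^sup>2)" for x y
  have [measurable]: "case_prod G \<in> borel_measurable (borel \<Otimes>\<^sub>M borel)"
    unfolding G_def by measurable
  have [measurable]: "G x \<in> borel_measurable borel" for x unfolding G_def by measurable
  have G: "ennreal ((f (d + c * x) - f (d + c * y))\<^sup>2 / (x - y)\<^sup>2)
      = ennreal c * (ennreal c * G (d + c * x) (d + c * y))" for x y
  proof -
    have "((d + c * x) - (d + c * y))\<^sup>2 = c * c * (x - y)\<^sup>2"
      by (simp add: power2_eq_square algebra_simps)
    then have "(f (d + c * x) - f (d + c * y))\<^sup>2 / (x - y)\<^sup>2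
        = c * (c * ((f (d + c * x) - f (d + c * y))\<^sup>2 / ((d + c * x) - (d + c * y))\<^sup>2))"
      using c by simp
    then show ?thesis using c unfolding G_def by (simp add: ennreal_mult'[symmetric])
  qed
  have "gagliardo_energy (1/2) (\<lambda>x. f (d + c * x)) =
      (\<integral>\<^sup>+ x. \<integral>\<^sup>+ y. ennreal c * (ennreal c * G (d + c * x) (d + c * y)) \<partial>lborel \<partial>lborel)"
    by (subst gagliardo_energy_iterated) (simp_all add: G)
  also have "\<dots> = (\<integral>\<^sup>+ x. ennreal c * (\<integral>\<^sup>+ y. G (d + c * x) y \<partial>lborel) \<partial>lborel)"
    using c by (subst (2) nn_integral_real_affine[of _ c d]) (simp_all add: nn_integral_cmult)
  also have "\<dots> = (\<integral>\<^sup>+ x. \<integral>\<^sup>+ y. G x y \<partial>lborel \<partial>lborel)"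
    using c by (subst (3) nn_integral_real_affine[of _ c d]) (simp_all add: nn_integral_cmult)
  also have "\<dots> = gagliardo_energy (1/2) f"
    by (subst gagliardo_energy_iterated) (simp_all add: G_def[abs_def])
  finally show ?thesis .
qed

lemma nn_integral_distance_le:
  fixes k :: "real \<Rightarrow> ennreal"
  assumes [measurable]: "k \<in> borel_measurable borel"
  shows "(\<integral>\<^sup>+ y. k \<bar>x - y\<bar> \<partial>lborel) \<le> 2 * (\<integral>\<^sup>+ t. k t * indicator {0..} t \<partial>lborel)"
proof -
  have "(\<integral>\<^sup>+ y. k \<bar>x - y\<bar> \<partial>lborel) \<le>
      (\<integral>\<^sup>+ y. k (x + -1 * y) * indicator {0..} (x + -1 * y) + k (- x + 1 * y) * indicator {0..} (- x + 1 * y) \<partial>lborel)"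
    by (intro nn_integral_mono) (auto simp: indicator_def abs_if)
  also have "\<dots> = (\<integral>\<^sup>+ t. k t * indicator {0..} t \<partial>lborel) + (\<integral>\<^sup>+ t. k t * indicator {0..} t \<partial>lborel)"
    using nn_integral_real_affine[of "\<lambda>t. k t * indicator {0..} t" "-1" x]
      nn_integral_real_affine[of "\<lambda>t. k t * indicator {0..} t" 1 "-x"]
    by (subst nn_integral_add) simp_all
  finally show ?thesis by (simp add: mult_2)
qed

lemma nn_integral_cauchy_kernel_le:
  assumes "A > 0"
  shows "(\<integral>\<^sup>+ y. ennreal (1 / (A\<^sup>2 + (x - y)\<^sup>2)) \<partial>lborel) \<le> ennreal (pi / A)"
proof -
  have pos: "A\<^sup>2 + t\<^sup>2 > 0" for t using assms by (simp add: add_pos_nonneg)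
  have "(\<integral>\<^sup>+ t. ennreal (1 / (A\<^sup>2 + t\<^sup>2)) * indicator {0..} t \<partial>lborel)
      = ennreal (pi / 2 / A - arctan (0 / A) / A)"
  proof (rule nn_integral_FTC_atLeast)
    show "((\<lambda>t. arctan (t / A) / A) has_real_derivative 1 / (A\<^sup>2 + x\<^sup>2)) (at x)" for x
    proof -
      have "A\<^sup>2 + x\<^sup>2 = A * A * (1 + (x / A)\<^sup>2)"
        using assms by (simp add: power2_eq_square distrib_left)
      moreover have "1 + (x / A)\<^sup>2 \<noteq> 0" by (metis add_pos_nonneg less_irrefl zero_le_power2 zero_less_one)
      ultimately show ?thesis using assms
        by (auto intro!: derivative_eq_intros simp: divide_inverse mult_ac)
    qed
    show "((\<lambda>t. arctan (t / A) / A) \<longlongrightarrow> pi / 2 / A) at_top"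
      using assms
      by (intro tendsto_divide tendsto_const filterlim_compose[OF tendsto_arctan_at_top]
          filterlim_at_top_mult_tendsto_pos[OF tendsto_const _ filterlim_ident, of "1 / A", simplified]) auto
  qed auto
  then show ?thesis
    using nn_integral_distance_le[of "\<lambda>t. ennreal (1 / (A\<^sup>2 + t\<^sup>2))" x] assms
    by (simp add: ennreal_mult'[symmetric] flip: ennreal_numeral)
qed

lemma nn_integral_kernel_tail_le:
  assumes "s > 0" "R > 0"
  shows "(\<integral>\<^sup>+ y. ennreal (\<bar>x - y\<bar> powr - (1 + 2 * s)) * indicator {R..} \<bar>x - y\<bar> \<partial>lborel)
      \<le> ennreal (R powr (- 2 * s) / s)"
proof -
  have "(\<integral>\<^sup>+ t. ennreal (t powr - (1 + 2 * s)) * indicator {R..} t \<partial>lborel)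
      = ennreal (0 - (- (R powr (- 2 * s) / (2 * s))))"
  proof (rule nn_integral_FTC_atLeast)
    show "((\<lambda>t. - (t powr (- 2 * s) / (2 * s))) has_real_derivative x powr - (1 + 2 * s)) (at x)"
      if "R \<le> x" for x
    proof -
      have exponent: "x powr (- (2 * s) - 1) = x powr (- 1 - 2 * s)"
        by (rule arg_cong[where f = "(powr) x"]) linarith
      show ?thesis using assms that by (auto intro!: derivative_eq_intros simp: exponent)
    qed
    have "((\<lambda>t. - (t powr (- 2 * s) / (2 * s))) \<longlongrightarrow> - (0 / (2 * s))) at_top"
      using assms by (intro tendsto_intros tendsto_neg_powr filterlim_ident) auto
    then show "((\<lambda>t. - (t powr (- 2 * s) / (2 * s))) \<longlongrightarrow> 0) at_top" by simp
  qed auto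
  moreover have "ennreal (t powr - (1 + 2 * s)) * indicator {R..} t * indicator {0..} t
      = ennreal (t powr - (1 + 2 * s)) * indicator {R..} t" for t :: real
    using assms by (auto simp: indicator_def)
  ultimately show ?thesis
    using nn_integral_distance_le[of "\<lambda>t. ennreal (t powr - (1 + 2 * s)) * indicator {R..} t" x] assms
    by (simp add: ennreal_mult'[symmetric] flip: ennreal_numeral)
qed

lemma borel_bump [measurable]: "bump \<in> borel_measurable borel"
  by (rule Ck_imp_borel_measurable[OF Ck_bump])

text \<open>Close to the diagonal the increment is controlled by the Lipschitz constant, far from it by the
  bound \<open>1\<close>; both are covered by the Cauchy density in \<open>x - y\<close>. Since the increment vanishes unless
  one of the two points lies in \<open>[- 2, 2]\<close>, the density is integrated over two strips of finite mass.\<close>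

lemma half_energy_bump_finite: "gagliardo_energy (1/2) bump < \<infinity>"
proof -
  obtain L where L: "L > 0" "\<And>x y. \<bar>bump x - bump y\<bar> \<le> L * \<bar>x - y\<bar>"
    using bump_lipschitz by blast
  define C where "C = 1 + L\<^sup>2"
  have C: "C \<ge> 0" by (simp add: C_def)
  let ?I = "indicator {-2..2} :: real \<Rightarrow> ennreal"
  let ?k = "\<lambda>x y :: real. ennreal C * ennreal (1 / (1\<^sup>2 + (x - y)\<^sup>2))"
  have k: "(\<integral>\<^sup>+ y. ?k x y \<partial>lborel) \<le> ennreal C * ennreal (pi / 1)" for x
    by (subst nn_integral_cmult) (use nn_integral_cauchy_kernel_le[of 1 x] in \<open>auto intro!: mult_left_mono\<close>)
  have k': "(\<integral>\<^sup>+ y. ?k y x \<partial>lborel) \<le> ennreal C * ennreal (pi / 1)" for x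
    using k[of x] by (simp add: power2_commute[of x])
  have le: "ennreal ((bump x - bump y)\<^sup>2 / norm (x - y) powr 2) \<le> ?k x y * ?I x + ?k x y * ?I y" for x y
  proof (cases "x = y \<or> \<bar>x\<bar> > 2 \<and> \<bar>y\<bar> > 2")
    case True
    then have "bump x = bump y" using bump_eq_0[of x] bump_eq_0[of y] by auto
    then show ?thesis by simp
  next
    case False
    define D z where "D = (bump x - bump y)\<^sup>2" and "z = (x - y)\<^sup>2"
    have z: "z > 0" using False by (simp add: z_def)
    have D: "D \<le> 1" using bump_bounds[of x] bump_bounds[of y]
      by (auto simp: D_def abs_square_le_1)
    moreover have "D \<le> L\<^sup>2 * z"
      using power_mono[OF L(2)[of x y], of 2] by (simp add: D_def z_def power_mult_distrib)
    moreover have "D * z \<le> 1 * z" using z D by (intro mult_right_mono) auto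
    ultimately have "D * (1 + z) \<le> C * z"
      unfolding C_def distrib_left distrib_right by linarith
    then have "D / z \<le> C * (1 / (1 + z))"
      using z by (simp add: divide_le_eq le_divide_eq)
    then have "ennreal (D / z) \<le> ?k x y"
      using C by (simp add: z_def ennreal_mult'[symmetric] ennreal_leI)
    also have "\<dots> = ?k x y * 1" by simp
    also have "\<dots> \<le> ?k x y * (?I x + ?I y)"
      by (rule mult_left_mono) (use False in \<open>auto simp: indicator_def\<close>)
    finally show ?thesis by (simp add: D_def z_def distrib_left)
  qed
  have "gagliardo_energy (1/2) bump \<le> (\<integral>\<^sup>+ (x, y). ?k x y * ?I x + ?k x y * ?I y \<partial>(lborel \<Otimes>\<^sub>M lborel))"
    unfolding gagliardo_energy_def by (intro nn_integral_mono) (use le in auto)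
  also have "\<dots> = (\<integral>\<^sup>+ (x, y). ?k x y * ?I x \<partial>(lborel \<Otimes>\<^sub>M lborel)) + (\<integral>\<^sup>+ (x, y). ?k x y * ?I y \<partial>(lborel \<Otimes>\<^sub>M lborel))"
    unfolding case_prod_beta by (rule nn_integral_add) auto
  finally have E: "gagliardo_energy (1/2) bump \<le> \<dots>" .
  let ?C = "ennreal C * ennreal (pi / 1)"
  have "(\<integral>\<^sup>+ (x, y). ?k x y * ?I x \<partial>(lborel \<Otimes>\<^sub>M lborel)) = (\<integral>\<^sup>+ x. (\<integral>\<^sup>+ y. ?k x y \<partial>lborel) * ?I x \<partial>lborel)"
    by (subst lborel.nn_integral_fst[symmetric]) (simp_all add: nn_integral_multc)
  also have "\<dots> \<le> (\<integral>\<^sup>+ x. ?C * ?I x \<partial>lborel)"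
    by (intro nn_integral_mono mult_right_mono k) simp
  finally have 1: "(\<integral>\<^sup>+ (x, y). ?k x y * ?I x \<partial>(lborel \<Otimes>\<^sub>M lborel)) \<le> \<dots>" .
  have "(\<integral>\<^sup>+ (x, y). ?k x y * ?I y \<partial>(lborel \<Otimes>\<^sub>M lborel)) = (\<integral>\<^sup>+ y. (\<integral>\<^sup>+ x. ?k x y \<partial>lborel) * ?I y \<partial>lborel)"
    by (subst lborel_pair.nn_integral_snd[symmetric]) (simp_all add: nn_integral_multc)
  also have "\<dots> \<le> (\<integral>\<^sup>+ x. ?C * ?I x \<partial>lborel)"
    by (intro nn_integral_mono mult_right_mono k') simp
  finally have 2: "(\<integral>\<^sup>+ (x, y). ?k x y * ?I y \<partial>(lborel \<Otimes>\<^sub>M lborel)) \<le> \<dots>" .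
  have "(\<integral>\<^sup>+ x. ?C * ?I x \<partial>lborel) = ?C * 4"
    by (subst nn_integral_cmult) simp_all
  then have "gagliardo_energy (1/2) bump \<le> ?C * 4 + ?C * 4"
    using order_trans[OF E add_mono[OF 1 2]] by simp
  also have "\<dots> < \<infinity>" by (simp add: ennreal_mult_less_top)
  finally show ?thesis .
qed

section \<open>Points have zero capacity at exponent one half\<close>

lemma half_energy_eq:
  fixes u :: "real \<Rightarrow> real"
  shows "gagliardo_energy (1/2) u
      = (\<integral>\<^sup>+ p. ennreal ((u (fst p) - u (snd p))\<^sup>2 / (fst p - snd p)\<^sup>2) \<partial>(lborel \<Otimes>\<^sub>M lborel))"
  unfolding gagliardo_energy_def by (intro nn_integral_cong) (simp add: split_beta)

text \<open>The neighbourhoods shrink to the union of the two axes, which is a null set. They are the pairs of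
  points at which a bump dilated by \<open>n\<close> can have a nonzero increment.\<close>

lemma half_energy_near_axes_tendsto_0:
  fixes w :: "real \<Rightarrow> real"
  assumes [measurable]: "w \<in> borel_measurable borel" and fin: "gagliardo_energy (1/2) w < \<infinity>"
  shows "(\<lambda>n. \<integral>\<^sup>+ p. ennreal ((w (fst p) - w (snd p))\<^sup>2 / (fst p - snd p)\<^sup>2) *
      indicator {p. \<bar>fst p\<bar> \<le> 2 / real n \<or> \<bar>snd p\<bar> \<le> 2 / real n} p \<partial>(lborel \<Otimes>\<^sub>M lborel)) \<longlonglongrightarrow> 0"
proof -
  let ?F = "\<lambda>p. ennreal ((w (fst p) - w (snd p))\<^sup>2 / (fst p - snd p)\<^sup>2)"
  let ?S = "\<lambda>n. {p :: real \<times> real. \<bar>fst p\<bar> \<le> 2 / real n \<or> \<bar>snd p\<bar> \<le> 2 / real n}"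
  have null: "AE p in lborel \<Otimes>\<^sub>M lborel. fst p \<noteq> (0::real) \<and> snd p \<noteq> (0::real)"
  proof -
    have z: "AE x in lborel. x \<noteq> (0::real)" by (rule AE_lborel_singleton)
    have "{p \<in> space (lborel \<Otimes>\<^sub>M lborel). fst p \<noteq> (0::real)} \<in> sets (lborel \<Otimes>\<^sub>M lborel)"
      by measurable
    then have 1: "AE p in lborel \<Otimes>\<^sub>M lborel. fst p \<noteq> (0::real)"
      by (rule lborel_pair.AE_pair_measure) (use z in auto)
    have "{p \<in> space (lborel \<Otimes>\<^sub>M lborel). snd p \<noteq> (0::real)} \<in> sets (lborel \<Otimes>\<^sub>M lborel)"
      by measurable
    then have 2: "AE p in lborel \<Otimes>\<^sub>M lborel. snd p \<noteq> (0::real)"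
      by (rule lborel_pair.AE_pair_measure) (use z in auto)
    from 1 2 show ?thesis by eventually_elim simp
  qed
  have "(\<lambda>n. \<integral>\<^sup>+ p. ?F p * indicator (?S n) p \<partial>(lborel \<Otimes>\<^sub>M lborel))
      \<longlonglongrightarrow> (\<integral>\<^sup>+ p. 0 \<partial>(lborel \<Otimes>\<^sub>M lborel :: (real \<times> real) measure))"
  proof (rule nn_integral_dominated_convergence[where w = ?F])
    show "(\<integral>\<^sup>+ p. ?F p \<partial>(lborel \<Otimes>\<^sub>M lborel)) < \<infinity>"
      using fin unfolding half_energy_eq .
    show "AE p in lborel \<Otimes>\<^sub>M lborel. (\<lambda>n. ?F p * indicator (?S n) p) \<longlonglongrightarrow> 0"
      using null
    proof eventually_elim
      fix p :: "real \<times> real"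
      assume p: "fst p \<noteq> 0 \<and> snd p \<noteq> 0"
      have lim: "(\<lambda>n. 2 / real n) \<longlonglongrightarrow> 0" by (rule lim_const_over_n)
      have "\<forall>\<^sub>F n in sequentially. 2 / real n < min \<bar>fst p\<bar> \<bar>snd p\<bar>"
        by (rule order_tendstoD(2)[OF lim]) (use p in auto)
      then have "\<forall>\<^sub>F n in sequentially. ?F p * indicator (?S n) p = 0"
        by eventually_elim auto
      then show "(\<lambda>n. ?F p * indicator (?S n) p) \<longlonglongrightarrow> 0" by (rule tendsto_eventually)
    qed
  qed (auto simp: indicator_def)
  then show ?thesis by simp
qed

text \<open>A concentrated bump is almost orthogonal to \<open>w\<close>. Off the cross-shaped set \<open>?S n\<close> below, the bump has no
  increment and the integrand of the sum is that of \<open>w\<close>; on \<open>?S n\<close> the square of a sum is at most twice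
  the sum of the squares, and the extra copy of the integrand of \<open>w\<close> has small integral there. What
  matters is the coefficient \<open>1\<close> of the energy of \<open>w\<close>: it makes energies grow only linearly when
  bumps are added one after the other.\<close>

lemma half_energy_add_concentrated_bump:
  fixes w :: "real \<Rightarrow> real"
  assumes [measurable]: "w \<in> borel_measurable borel" and fin: "gagliardo_energy (1/2) w < \<infinity>"
  shows "\<exists>c\<ge>\<Lambda>. c > 0 \<and> gagliardo_energy (1/2) (\<lambda>x. w x + bump (c * x))
      \<le> gagliardo_energy (1/2) w + 2 * gagliardo_energy (1/2) bump + 1"
proof -
  let ?F = "\<lambda>p. ennreal ((w (fst p) - w (snd p))\<^sup>2 / (fst p - snd p)\<^sup>2)"
  let ?S = "\<lambda>n. {p :: real \<times> real. \<bar>fst p\<bar> \<le> 2 / real n \<or> \<bar>snd p\<bar> \<le> 2 / real n}"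
  have "\<forall>\<^sub>F n in sequentially. (\<integral>\<^sup>+ p. ?F p * indicator (?S n) p \<partial>(lborel \<Otimes>\<^sub>M lborel)) < 1"
    by (rule order_tendstoD(2)[OF half_energy_near_axes_tendsto_0]) (use assms in auto)
  moreover have "\<forall>\<^sub>F n in sequentially. real n \<ge> max \<Lambda> 1"
    using filterlim_real_sequentially unfolding filterlim_at_top by blast
  ultimately have "\<forall>\<^sub>F n in sequentially. (\<integral>\<^sup>+ p. ?F p * indicator (?S n) p \<partial>(lborel \<Otimes>\<^sub>M lborel)) < 1 \<and> real n \<ge> max \<Lambda> 1"
    by (rule eventually_conj)
  then obtain n where n: "(\<integral>\<^sup>+ p. ?F p * indicator (?S n) p \<partial>(lborel \<Otimes>\<^sub>M lborel)) < 1" "real n \<ge> max \<Lambda> 1"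
    using eventually_happens by fastforce
  let ?b = "\<lambda>x. bump (real n * x)"
  let ?B = "\<lambda>p. ennreal ((?b (fst p) - ?b (snd p))\<^sup>2 / (fst p - snd p)\<^sup>2)"
  have npos: "real n > 0" using n(2) by simp
  have b0: "?b x = 0" if "\<not> \<bar>x\<bar> \<le> 2 / real n" for x
    by (rule bump_eq_0) (use that npos in \<open>auto simp: abs_mult field_simps\<close>)
  \<comment> \<open>the cross term is paid for only on the cross-shaped set around the axes\<close>
  have le: "ennreal (((w x + ?b x) - (w y + ?b y))\<^sup>2 / (x - y)\<^sup>2)
      \<le> ?F (x, y) + 2 * ?B (x, y) + ?F (x, y) * indicator (?S n) (x, y)" for x y
  proof (cases "(x, y) \<in> ?S n")
    case True
    have "((w x + ?b x) - (w y + ?b y))\<^sup>2 = ((w x - w y) + (?b x - ?b y))\<^sup>2"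
      by (simp add: algebra_simps)
    also have "\<dots> \<le> 2 * (w x - w y)\<^sup>2 + 2 * (?b x - ?b y)\<^sup>2" by (rule square_add_le)
    finally have "((w x + ?b x) - (w y + ?b y))\<^sup>2 / (x - y)\<^sup>2
        \<le> (2 * (w x - w y)\<^sup>2 + 2 * (?b x - ?b y)\<^sup>2) / (x - y)\<^sup>2"
      by (rule divide_right_mono) simp
    also have "\<dots> = 2 * ((w x - w y)\<^sup>2 / (x - y)\<^sup>2) + 2 * ((?b x - ?b y)\<^sup>2 / (x - y)\<^sup>2)"
      by (simp add: add_divide_distrib)
    finally have "ennreal (((w x + ?b x) - (w y + ?b y))\<^sup>2 / (x - y)\<^sup>2)
        \<le> ennreal (2 * ((w x - w y)\<^sup>2 / (x - y)\<^sup>2) + 2 * ((?b x - ?b y)\<^sup>2 / (x - y)\<^sup>2))"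
      by (rule ennreal_leI)
    also have "\<dots> = 2 * ?F (x, y) + 2 * ?B (x, y)"
      unfolding fst_conv snd_conv by (rule ennreal_double_add) auto
    finally show ?thesis using True by (simp add: mult_2 add_ac)
  next
    case False
    then show ?thesis by (simp add: b0)
  qed
  have "gagliardo_energy (1/2) (\<lambda>x. w x + ?b x)
      \<le> (\<integral>\<^sup>+ p. ?F p + 2 * ?B p + ?F p * indicator (?S n) p \<partial>(lborel \<Otimes>\<^sub>M lborel))"
    unfolding half_energy_eq
  proof (rule nn_integral_mono)
    fix p :: "real \<times> real"
    show "ennreal (((w (fst p) + ?b (fst p)) - (w (snd p) + ?b (snd p)))\<^sup>2 / (fst p - snd p)\<^sup>2)
        \<le> ?F p + 2 * ?B p + ?F p * indicator (?S n) p"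
      using le[of "fst p" "snd p"] unfolding prod.collapse .
  qed
  also have "\<dots> = (\<integral>\<^sup>+ p. ?F p \<partial>(lborel \<Otimes>\<^sub>M lborel)) + 2 * (\<integral>\<^sup>+ p. ?B p \<partial>(lborel \<Otimes>\<^sub>M lborel))
      + (\<integral>\<^sup>+ p. ?F p * indicator (?S n) p \<partial>(lborel \<Otimes>\<^sub>M lborel))"
    by (simp add: nn_integral_add nn_integral_cmult)
  also have "\<dots> \<le> gagliardo_energy (1/2) w + 2 * gagliardo_energy (1/2) ?b + 1"
    unfolding half_energy_eq using n(1) by (intro add_mono order.refl less_imp_le)
  also have "gagliardo_energy (1/2) ?b = gagliardo_energy (1/2) bump"
    using half_energy_affine_invariant[OF borel_bump npos, of 0] by simp
  finally show ?thesis using n(2) npos by (intro exI[of _ "real n"]) auto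
qed

text \<open>Height \<open>K\<close> costs only energy \<open>O(K)\<close>, whereas multiplying one bump by \<open>K\<close> would cost \<open>K\<^sup>2\<close>.\<close>

lemma exists_bump_tower:
  fixes K :: nat
  assumes "\<delta> > 0"
  shows "\<exists>w :: real \<Rightarrow> real. (\<forall>k. Ck k w) \<and> (\<forall>x. 0 \<le> w x \<and> w x \<le> real K) \<and>
      (\<exists>r>0. \<forall>x. \<bar>x\<bar> < r \<longrightarrow> w x = real K) \<and> (\<forall>x. \<bar>x\<bar> \<ge> \<delta> \<longrightarrow> w x = 0) \<and>
      gagliardo_energy (1/2) w \<le> of_nat K * (2 * gagliardo_energy (1/2) bump + 1)"
proof (induction K)
  case 0
  show ?case
    by (rule exI[of _ "\<lambda>_. 0"]) (auto simp: Ck_const gagliardo_energy_const intro: exI[of _ 1])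
next
  case (Suc K)
  let ?M = "2 * gagliardo_energy (1/2) bump + 1"
  from Suc obtain w r where w: "\<And>k. Ck k w" "\<And>x. 0 \<le> w x" "\<And>x. w x \<le> real K"
    "r > 0" "\<And>x. \<bar>x\<bar> < r \<Longrightarrow> w x = real K" "\<And>x. \<bar>x\<bar> \<ge> \<delta> \<Longrightarrow> w x = 0"
    "gagliardo_energy (1/2) w \<le> of_nat K * ?M" by blast
  have [measurable]: "w \<in> borel_measurable borel" by (rule Ck_imp_borel_measurable[OF w(1)])
  have "of_nat K * ?M < \<infinity>"
    using half_energy_bump_finite by (simp add: ennreal_mult_less_top of_nat_less_top)
  then have "gagliardo_energy (1/2) w < \<infinity>" using w(7) le_less_trans by blast
  then obtain c where c: "c \<ge> 2 / \<delta>" "c > 0"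
    "gagliardo_energy (1/2) (\<lambda>x. w x + bump (c * x)) \<le> gagliardo_energy (1/2) w + 2 * gagliardo_energy (1/2) bump + 1"
    using half_energy_add_concentrated_bump[of w "2 / \<delta>"] by auto
  have "bump (c * x) = 0" if "\<bar>x\<bar> \<ge> \<delta>" for x
  proof (rule bump_eq_0)
    have "2 \<le> c * \<delta>" using c(1) assms by (simp add: field_simps)
    also have "\<dots> \<le> \<bar>c * x\<bar>" using c that by (simp add: abs_mult)
    finally show "2 \<le> \<bar>c * x\<bar>" .
  qed
  moreover have "bump (c * x) = 1" if "\<bar>x\<bar> < 1 / c" for x
    by (rule bump_eq_1) (use c that in \<open>auto simp: abs_mult field_simps\<close>)
  moreover have "Ck k (\<lambda>x. w x + bump (c * x))" for k
    by (intro Ck_add w Ck_compose_affine[OF Ck_bump]) (auto intro!: derivative_eq_intros)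
  moreover have "0 \<le> w x + bump (c * x) \<and> w x + bump (c * x) \<le> real (Suc K)" for x
    using w(2,3)[of x] bump_bounds[of "c * x"] by auto
  moreover have "gagliardo_energy (1/2) (\<lambda>x. w x + bump (c * x)) \<le> of_nat (Suc K) * ?M"
  proof -
    have "gagliardo_energy (1/2) (\<lambda>x. w x + bump (c * x)) \<le> of_nat K * ?M + ?M"
      using order_trans[OF c(3) add_right_mono[OF add_right_mono[OF w(7)]]] by (simp add: add.assoc)
    then show ?thesis by (simp add: distrib_right add.commute)
  qed
  ultimately show ?case using w c
    by (intro exI[of _ "\<lambda>x. w x + bump (c * x)"] conjI exI[of _ "min r (1 / c)"]) auto
qed

text \<open>The energy is quadratic, so dividing a tower of height \<open>K\<close> and energy \<open>O(K)\<close> by \<open>K\<close> leaves energy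
  \<open>O(1 / K)\<close>; the cutoff is one minus the result.\<close>

lemma exists_cutoff_small_half_energy:
  assumes "\<epsilon> > 0" "\<delta> > 0"
  shows "\<exists>g :: real \<Rightarrow> real. (\<forall>k. Ck k g) \<and> (\<forall>x. 0 \<le> g x \<and> g x \<le> 1) \<and>
      (\<exists>r>0. \<forall>x. \<bar>x\<bar> < r \<longrightarrow> g x = 0) \<and> (\<forall>x. \<bar>x\<bar> \<ge> \<delta> \<longrightarrow> g x = 1) \<and>
      gagliardo_energy (1/2) g \<le> ennreal \<epsilon>"
proof -
  have "2 * gagliardo_energy (1/2) bump + 1 < \<infinity>"
    using half_energy_bump_finite by (simp add: ennreal_mult_less_top)
  then obtain M where M: "M \<ge> 0" "2 * gagliardo_energy (1/2) bump + 1 = ennreal M"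
    by (metis infinity_ennreal_def less_top_ennreal)
  \<comment> \<open>the lower bound \<open>1\<close> only ensures that the division by \<open>K\<close> makes sense\<close>
  obtain K :: nat where K: "real K > max 1 (M / \<epsilon>)" using reals_Archimedean2 by blast
  then have Kpos: "real K > 0" "K > 0" by auto
  obtain w r where w: "\<And>k. Ck k w" "\<And>x. 0 \<le> w x" "\<And>x. w x \<le> real K"
    "r > 0" "\<And>x. \<bar>x\<bar> < r \<Longrightarrow> w x = real K" "\<And>x. \<bar>x\<bar> \<ge> \<delta> \<Longrightarrow> w x = 0"
    "gagliardo_energy (1/2) w \<le> of_nat K * ennreal M"
    using exists_bump_tower[OF assms(2), of K] unfolding M(2) by blast
  define g where "g = (\<lambda>x. 1 - 1 / real K * w x)"
  have "gagliardo_energy (1/2) g = ennreal ((1 / real K)\<^sup>2) * gagliardo_energy (1/2) w"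
    unfolding g_def by (rule gagliardo_energy_affine_values[OF Ck_imp_borel_measurable[OF w(1)]])
  also have "\<dots> \<le> ennreal ((1 / real K)\<^sup>2) * (of_nat K * ennreal M)"
    by (intro mult_left_mono w) simp
  also have "\<dots> = ennreal (M / real K)"
    using Kpos M(1) by (simp add: ennreal_of_nat_eq_real_of_nat ennreal_mult'[symmetric] power2_eq_square)
  also have "\<dots> \<le> ennreal \<epsilon>"
    using K Kpos assms by (intro ennreal_leI) (simp add: field_simps)
  finally have "gagliardo_energy (1/2) g \<le> ennreal \<epsilon>" .
  moreover have "Ck k g" for k
    unfolding g_def by (intro Ck_diff Ck_mult Ck_const w)
  ultimately show ?thesis using w Kpos
    by (intro exI[of _ g] conjI exI[of _ r]) (auto simp: g_def field_simps)
qed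

text \<open>Multiplying by the cutoff at one more point costs a factor \<open>2\<close> in the energy bounds, whence the choice of
  \<open>\<epsilon> / 4\<close> for both factors in the induction step.\<close>

lemma exists_cutoff_at_integers:
  fixes n :: nat
  assumes "\<epsilon> > 0" "\<delta> > 0"
  shows "\<exists>g :: real \<Rightarrow> real. (\<forall>k. Ck k g) \<and> (\<forall>x. 0 \<le> g x \<and> g x \<le> 1) \<and>
      (\<exists>r>0. \<forall>i<n. \<forall>x. \<bar>x - real i\<bar> < r \<longrightarrow> g x = 0) \<and>
      emeasure lborel {x. g x \<noteq> 1} \<le> ennreal \<delta> \<and> gagliardo_energy (1/2) g \<le> ennreal \<epsilon>"
  using assms
proof (induction n arbitrary: \<epsilon> \<delta>)
  case 0
  then show ?case
    by (intro exI[of _ "\<lambda>_. 1"]) (auto simp: Ck_const gagliardo_energy_const intro: exI[of _ 1])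
next
  case (Suc n)
  have pos: "\<epsilon> / 4 > 0" "\<delta> / 2 > 0" "\<delta> / 4 > 0" using Suc.prems by auto
  obtain g r where g: "\<And>k. Ck k g" "\<And>x. 0 \<le> g x" "\<And>x. g x \<le> 1"
    "r > 0" "\<And>i x. i < n \<Longrightarrow> \<bar>x - real i\<bar> < r \<Longrightarrow> g x = 0"
    "emeasure lborel {x. g x \<noteq> 1} \<le> ennreal (\<delta> / 2)" "gagliardo_energy (1/2) g \<le> ennreal (\<epsilon> / 4)"
    using Suc.IH[OF pos(1,2)] by blast
  obtain h q where h: "\<And>k. Ck k h" "\<And>x. 0 \<le> h x" "\<And>x. h x \<le> 1"
    "q > 0" "\<And>x. \<bar>x\<bar> < q \<Longrightarrow> h x = 0" "\<And>x. \<bar>x\<bar> \<ge> \<delta> / 4 \<Longrightarrow> h x = 1"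
    "gagliardo_energy (1/2) h \<le> ennreal (\<epsilon> / 4)"
    using exists_cutoff_small_half_energy[OF pos(1,3)] by blast
  define h' where "h' = (\<lambda>x. h (- real n + 1 * x))"
  have Ck_h': "Ck k h'" for k
    unfolding h'_def by (intro Ck_compose_affine[OF h(1)]) (auto intro!: derivative_eq_intros)
  have meas [measurable]: "g \<in> borel_measurable borel" "h' \<in> borel_measurable borel"
    using Ck_imp_borel_measurable g(1) Ck_h' by blast+
  have "gagliardo_energy (1/2) h' \<le> ennreal (\<epsilon> / 4)"
    unfolding h'_def using half_energy_affine_invariant[OF Ck_imp_borel_measurable[OF h(1)], of 1 "- real n"] h(7) by simp
  then have "2 * gagliardo_energy (1/2) g + 2 * gagliardo_energy (1/2) h' \<le> 2 * ennreal (\<epsilon> / 4) + 2 * ennreal (\<epsilon> / 4)"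
    by (intro add_mono mult_left_mono g(7)) auto
  moreover have "\<dots> = ennreal \<epsilon>"
    using Suc.prems by (subst ennreal_double_add[symmetric]) auto
  moreover have "gagliardo_energy (1/2) (\<lambda>x. g x * h' x) \<le> 2 * gagliardo_energy (1/2) g + 2 * gagliardo_energy (1/2) h'"
    by (rule gagliardo_energy_mult_le[OF meas]) (use g h in \<open>auto simp: h'_def\<close>)
  ultimately have "gagliardo_energy (1/2) (\<lambda>x. g x * h' x) \<le> ennreal \<epsilon>" by simp
  moreover have "emeasure lborel {x. g x * h' x \<noteq> 1} \<le> ennreal \<delta>"
  proof -
    have "{x. g x * h' x \<noteq> 1} \<subseteq> {x. g x \<noteq> 1} \<union> {real n - \<delta> / 4..real n + \<delta> / 4}"
      using h(6) by (auto simp: h'_def abs_if not_le split: if_splits)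
    then have "emeasure lborel {x. g x * h' x \<noteq> 1} \<le> emeasure lborel ({x. g x \<noteq> 1} \<union> {real n - \<delta> / 4..real n + \<delta> / 4})"
      by (rule emeasure_mono) measurable
    also have "\<dots> \<le> emeasure lborel {x. g x \<noteq> 1} + emeasure lborel {real n - \<delta> / 4..real n + \<delta> / 4}"
      by (rule emeasure_subadditive) measurable
    also have "\<dots> \<le> ennreal (\<delta> / 2) + ennreal (\<delta> / 2)"
      using Suc.prems by (intro add_mono g(6)) simp
    also have "\<dots> = ennreal \<delta>" using Suc.prems by (subst ennreal_plus[symmetric]) auto
    finally show ?thesis .
  qed
  moreover have "Ck k (\<lambda>x. g x * h' x)" for k by (intro Ck_mult g Ck_h')
  moreover have "0 \<le> g x * h' x \<and> g x * h' x \<le> 1" for x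
    using g(2,3)[of x] h(2,3)[of "- real n + 1 * x"] by (auto simp: h'_def mult_le_one)
  moreover have "g x * h' x = 0" if "i < Suc n" "\<bar>x - real i\<bar> < min r q" for i x
    using that g(5)[of i x] h(5)[of "x - real n"] by (auto simp: h'_def less_Suc_eq)
  ultimately show ?case using g(4) h(4)
    by (intro exI[of _ "\<lambda>x. g x * h' x"] conjI exI[of _ "min r q"]) auto
qed

text \<open>The profile is the bump stretched to \<open>[m / 4, 3 m / 4]\<close>, with unchanged energy by dilation
  invariance, times a cutoff at the integers \<open>0, \<dots>, m\<close>. It equals \<open>1\<close> on an interval of length
  \<open>m / 4\<close> except for a set of measure at most \<open>1 / 8\<close>, which the cutoff spoils.\<close>

lemma exists_half_energy_test_profile:
  fixes m :: nat
  assumes m: "m \<ge> 1"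
  shows "\<exists>a :: real \<Rightarrow> real. (\<forall>k. Ck k a) \<and> (\<forall>x. \<bar>a x\<bar> \<le> 1) \<and>
      (\<exists>r>0. \<forall>i\<le>m. \<forall>x. \<bar>x - real i\<bar> < r \<longrightarrow> a x = 0) \<and>
      (\<forall>x. x \<notin> {real m / 4..3 * real m / 4} \<longrightarrow> a x = 0) \<and>
      gagliardo_energy (1/2) a \<le> 2 * gagliardo_energy (1/2) bump + 2 \<and>
      ennreal (real m / 8) \<le> (\<integral>\<^sup>+ x. ennreal ((a x)\<^sup>2) \<partial>lborel)"
proof -
  have eighth: "1 / 8 > (0::real)" by simp
  obtain g r where g: "\<And>k. Ck k g" "\<And>x. 0 \<le> g x" "\<And>x. g x \<le> 1"
    "r > 0" "\<And>i x. i < Suc m \<Longrightarrow> \<bar>x - real i\<bar> < r \<Longrightarrow> g x = 0"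
    "emeasure lborel {x. g x \<noteq> 1} \<le> ennreal (1 / 8)" "gagliardo_energy (1/2) g \<le> ennreal 1"
    using exists_cutoff_at_integers[OF zero_less_one, of "1 / 8" "Suc m", OF eighth] by blast
  \<comment> \<open>sends \<open>[m / 4, 3 m / 4]\<close> to the interval \<open>[- 2, 2]\<close> that contains the support of the bump\<close>
  define b where "b = (\<lambda>x. bump (- 4 + 8 / real m * x))"
  have mpos: "real m > 0" using m by simp
  have Ck_b: "Ck k b" for k
    unfolding b_def by (intro Ck_compose_affine[OF Ck_bump]) (use m in \<open>auto intro!: derivative_eq_intros\<close>)
  have meas [measurable]: "b \<in> borel_measurable borel" "g \<in> borel_measurable borel"
    using Ck_imp_borel_measurable g(1) Ck_b by blast+
  have b: "0 \<le> b x" "b x \<le> 1" for x by (simp_all add: b_def bump_bounds)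
  have "gagliardo_energy (1/2) (\<lambda>x. b x * g x) \<le> 2 * gagliardo_energy (1/2) b + 2 * gagliardo_energy (1/2) g"
    by (rule gagliardo_energy_mult_le[OF meas]) (use g b in auto)
  also have "gagliardo_energy (1/2) b = gagliardo_energy (1/2) bump"
    unfolding b_def by (rule half_energy_affine_invariant) (use m in auto)
  also have "2 * gagliardo_energy (1/2) bump + 2 * gagliardo_energy (1/2) g \<le> 2 * gagliardo_energy (1/2) bump + 2 * 1"
    using g(7) by (intro add_mono mult_left_mono) auto
  finally have E: "gagliardo_energy (1/2) (\<lambda>x. b x * g x) \<le> 2 * gagliardo_energy (1/2) bump + 2" by simp
  let ?I = "{3 * real m / 8..5 * real m / 8}"
  let ?X = "\<integral>\<^sup>+ x. ennreal ((b x * g x)\<^sup>2) \<partial>lborel"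
  have b1: "b x = 1" if "x \<in> ?I" for x
    unfolding b_def by (rule bump_eq_1) (use that mpos in \<open>auto simp: abs_if field_simps\<close>)
  have b0: "b x = 0" if "x \<notin> {real m / 4..3 * real m / 4}" for x
    unfolding b_def by (rule bump_eq_0) (use that mpos in \<open>auto simp: abs_if field_simps\<close>)
  have "ennreal (real m / 4) = emeasure lborel ?I" using mpos by simp
  also have "\<dots> = (\<integral>\<^sup>+ x. indicator ?I x \<partial>lborel)" by simp
  also have "\<dots> \<le> (\<integral>\<^sup>+ x. ennreal ((b x * g x)\<^sup>2) + indicator {x. g x \<noteq> 1} x \<partial>lborel)"
    by (intro nn_integral_mono) (auto simp: indicator_def b1)
  also have "\<dots> = ?X + emeasure lborel {x. g x \<noteq> 1}"
    by (subst nn_integral_add) auto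
  also have "\<dots> \<le> ?X + ennreal (1 / 8)" by (intro add_mono g(6)) simp
  finally have "ennreal (real m / 4) \<le> ?X + ennreal (1 / 8)" .
  then have "ennreal (real m / 4 - 1 / 8) \<le> ?X"
    by (cases ?X) (auto simp: ennreal_plus[symmetric] simp del: ennreal_plus)
  moreover have "ennreal (real m / 8) \<le> ennreal (real m / 4 - 1 / 8)"
    using m by (intro ennreal_leI) simp
  ultimately have X: "ennreal (real m / 8) \<le> ?X" by order
  have "Ck k (\<lambda>x. b x * g x)" for k by (intro Ck_mult g Ck_b)
  moreover have "\<bar>b x * g x\<bar> \<le> 1" for x
    using b[of x] g(2,3)[of x] by (simp add: mult_le_one)
  moreover have "b x * g x = 0" if "i \<le> m" "\<bar>x - real i\<bar> < r" for i x
    using g(5)[of i x] that by simp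
  ultimately show ?thesis using E X g(4) b0
    by (intro exI[of _ "\<lambda>x. b x * g x"] conjI exI[of _ r]) auto
qed

section \<open>Interpolation between exponents\<close>

text \<open>At distances below \<open>R\<close> the two kernels differ by at most the factor \<open>R\<close> to the power \<open>1 - 2 s\<close>; this is
  where \<open>s \<le> 1 / 2\<close> enters. At larger distances the kernel of order \<open>s\<close> is integrable
  in each variable, and the increment is estimated by the two values separately.\<close>

lemma half_energy_interpolation:
  fixes f :: "real \<Rightarrow> real"
  assumes [measurable]: "f \<in> borel_measurable borel" and s: "0 < s" "s \<le> 1 / 2" and R: "R > 0"
  shows "gagliardo_energy s f \<le> ennreal (R powr (1 - 2 * s)) * gagliardo_energy (1/2) f
      + ennreal (4 / s * R powr (- 2 * s)) * (\<integral>\<^sup>+ x. ennreal ((f x)\<^sup>2) \<partial>lborel)"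
proof -
  let ?k = "\<lambda>x y :: real. ennreal (\<bar>x - y\<bar> powr - (1 + 2 * s)) * indicator {R..} \<bar>x - y\<bar>"
  let ?N = "\<integral>\<^sup>+ x. ennreal ((f x)\<^sup>2) \<partial>lborel"
  let ?near = "\<lambda>x y. ennreal (R powr (1 - 2 * s)) * ennreal ((f x - f y)\<^sup>2 / (x - y)\<^sup>2)"
  have le: "ennreal ((f x - f y)\<^sup>2 / \<bar>x - y\<bar> powr (1 + 2 * s))
      \<le> ?near x y + (2 * ennreal ((f x)\<^sup>2) + 2 * ennreal ((f y)\<^sup>2)) * ?k x y" for x y
  proof (cases "\<bar>x - y\<bar> \<ge> R")
    case True
    have nonneg: "0 \<le> 2 * (f x)\<^sup>2 + 2 * (- f y)\<^sup>2" by simp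
    have "(f x - f y)\<^sup>2 / \<bar>x - y\<bar> powr (1 + 2 * s) = (f x + - f y)\<^sup>2 * \<bar>x - y\<bar> powr - (1 + 2 * s)"
      by (simp only: powr_minus divide_inverse diff_conv_add_uminus)
    also have "\<dots> \<le> (2 * (f x)\<^sup>2 + 2 * (- f y)\<^sup>2) * \<bar>x - y\<bar> powr - (1 + 2 * s)"
      by (intro mult_right_mono square_add_le) simp
    finally have "ennreal ((f x - f y)\<^sup>2 / \<bar>x - y\<bar> powr (1 + 2 * s))
        \<le> ennreal ((2 * (f x)\<^sup>2 + 2 * (- f y)\<^sup>2) * \<bar>x - y\<bar> powr - (1 + 2 * s))"
      by (rule ennreal_leI)
    also have "\<dots> = (2 * ennreal ((f x)\<^sup>2) + 2 * ennreal ((f y)\<^sup>2)) * ennreal (\<bar>x - y\<bar> powr - (1 + 2 * s))"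
      by (subst ennreal_mult[OF nonneg powr_ge_zero])
        (simp only: ennreal_double_add power2_minus zero_le_power2)
    also have "\<dots> \<le> ?near x y + (2 * ennreal ((f x)\<^sup>2) + 2 * ennreal ((f y)\<^sup>2)) * ?k x y"
      using True by (simp add: add_increasing)
    finally show ?thesis .
  next
    case False
    have "(f x - f y)\<^sup>2 / \<bar>x - y\<bar> powr (1 + 2 * s) \<le> R powr (1 - 2 * s) * ((f x - f y)\<^sup>2 / (x - y)\<^sup>2)"
    proof (cases "x = y")
      case neq: False
      have "\<bar>x - y\<bar> powr (1 - 2 * s) \<le> R powr (1 - 2 * s)"
        using False s by (intro powr_mono2) auto
      moreover have "1 / \<bar>x - y\<bar> powr (1 + 2 * s) = \<bar>x - y\<bar> powr (1 - 2 * s) / (x - y)\<^sup>2"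
      proof -
        have "\<bar>x - y\<bar> powr (1 - 2 * s) * \<bar>x - y\<bar> powr (1 + 2 * s) = \<bar>x - y\<bar> powr 2"
          by (simp flip: powr_add)
        also have "\<dots> = (x - y)\<^sup>2" using neq by simp
        finally show ?thesis using neq by (simp add: divide_eq_eq)
      qed
      ultimately have "1 / \<bar>x - y\<bar> powr (1 + 2 * s) \<le> R powr (1 - 2 * s) / (x - y)\<^sup>2"
        by (simp add: divide_right_mono)
      from mult_left_mono[OF this, of "(f x - f y)\<^sup>2"] show ?thesis by (simp add: mult_ac)
    qed simp
    then have "ennreal ((f x - f y)\<^sup>2 / \<bar>x - y\<bar> powr (1 + 2 * s))
        \<le> ennreal (R powr (1 - 2 * s) * ((f x - f y)\<^sup>2 / (x - y)\<^sup>2))"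
      by (rule ennreal_leI)
    also have "\<dots> = ?near x y" by (rule ennreal_mult) simp_all
    finally show ?thesis by (rule order_trans) simp
  qed
  have k: "(\<integral>\<^sup>+ y. ?k x y \<partial>lborel) \<le> ennreal (R powr (- 2 * s) / s)" for x
    using nn_integral_kernel_tail_le[OF s(1) R, of x] by simp
  have k': "(\<integral>\<^sup>+ x. ?k x y \<partial>lborel) \<le> ennreal (R powr (- 2 * s) / s)" for y
    using k[of y] by (simp add: abs_minus_commute)
  let ?A = "\<lambda>p. ennreal ((f (fst p))\<^sup>2) * ?k (fst p) (snd p)"
  let ?B = "\<lambda>p. ennreal ((f (snd p))\<^sup>2) * ?k (fst p) (snd p)"
  have A: "(\<integral>\<^sup>+ p. ?A p \<partial>(lborel \<Otimes>\<^sub>M lborel)) \<le> ?N * ennreal (R powr (- 2 * s) / s)"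
  proof -
    have "(\<integral>\<^sup>+ p. ?A p \<partial>(lborel \<Otimes>\<^sub>M lborel)) = (\<integral>\<^sup>+ x. ennreal ((f x)\<^sup>2) * (\<integral>\<^sup>+ y. ?k x y \<partial>lborel) \<partial>lborel)"
      by (subst lborel.nn_integral_fst[symmetric]) (simp_all add: nn_integral_cmult)
    also have "\<dots> \<le> (\<integral>\<^sup>+ x. ennreal ((f x)\<^sup>2) * ennreal (R powr (- 2 * s) / s) \<partial>lborel)"
      by (intro nn_integral_mono mult_left_mono k) simp
    also have "\<dots> = ?N * ennreal (R powr (- 2 * s) / s)" by (rule nn_integral_multc) simp
    finally show ?thesis .
  qed
  have B: "(\<integral>\<^sup>+ p. ?B p \<partial>(lborel \<Otimes>\<^sub>M lborel)) \<le> ?N * ennreal (R powr (- 2 * s) / s)"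
  proof -
    have "(\<integral>\<^sup>+ p. ?B p \<partial>(lborel \<Otimes>\<^sub>M lborel)) = (\<integral>\<^sup>+ y. ennreal ((f y)\<^sup>2) * (\<integral>\<^sup>+ x. ?k x y \<partial>lborel) \<partial>lborel)"
      by (subst lborel_pair.nn_integral_snd[symmetric]) (simp_all add: nn_integral_cmult)
    also have "\<dots> \<le> (\<integral>\<^sup>+ y. ennreal ((f y)\<^sup>2) * ennreal (R powr (- 2 * s) / s) \<partial>lborel)"
      by (intro nn_integral_mono mult_left_mono k') simp
    also have "\<dots> = ?N * ennreal (R powr (- 2 * s) / s)" by (rule nn_integral_multc) simp
    finally show ?thesis .
  qed
  have "gagliardo_energy s f \<le> (\<integral>\<^sup>+ p. ?near (fst p) (snd p) + (2 * ?A p + 2 * ?B p) \<partial>(lborel \<Otimes>\<^sub>M lborel))"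
    unfolding gagliardo_energy_def
  proof (rule nn_integral_mono)
    fix p :: "real \<times> real"
    show "(case p of (x, y) \<Rightarrow> ennreal (\<bar>f x - f y\<bar>\<^sup>2 / norm (x - y) powr (real DIM(real) + 2 * s)))
        \<le> ?near (fst p) (snd p) + (2 * ?A p + 2 * ?B p)"
      using le[of "fst p" "snd p"] by (simp add: split_beta distrib_right mult.assoc)
  qed
  also have "\<dots> = (\<integral>\<^sup>+ p. ?near (fst p) (snd p) \<partial>(lborel \<Otimes>\<^sub>M lborel))
      + (2 * (\<integral>\<^sup>+ p. ?A p \<partial>(lborel \<Otimes>\<^sub>M lborel)) + 2 * (\<integral>\<^sup>+ p. ?B p \<partial>(lborel \<Otimes>\<^sub>M lborel)))"
    by (simp add: nn_integral_add nn_integral_cmult del: ennreal_mult)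
  also have "(\<integral>\<^sup>+ p. ?near (fst p) (snd p) \<partial>(lborel \<Otimes>\<^sub>M lborel))
      = ennreal (R powr (1 - 2 * s)) * gagliardo_energy (1/2) f"
    unfolding half_energy_eq by (rule nn_integral_cmult) measurable
  also have "ennreal (R powr (1 - 2 * s)) * gagliardo_energy (1/2) f
      + (2 * (\<integral>\<^sup>+ p. ?A p \<partial>(lborel \<Otimes>\<^sub>M lborel)) + 2 * (\<integral>\<^sup>+ p. ?B p \<partial>(lborel \<Otimes>\<^sub>M lborel)))
    \<le> ennreal (R powr (1 - 2 * s)) * gagliardo_energy (1/2) f
      + (2 * (?N * ennreal (R powr (- 2 * s) / s)) + 2 * (?N * ennreal (R powr (- 2 * s) / s)))"
    by (intro add_mono mult_left_mono A B order.refl) simp_all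
  also have "2 * (?N * ennreal (R powr (- 2 * s) / s)) + 2 * (?N * ennreal (R powr (- 2 * s) / s))
      = 4 * ennreal (R powr (- 2 * s) / s) * ?N"
    by (simp add: mult_ac flip: distrib_right)
  also have "4 * ennreal (R powr (- 2 * s) / s) = ennreal (4 / s * R powr (- 2 * s))"
  proof -
    have "4 / s * R powr (- 2 * s) = 4 * (R powr (- 2 * s) / s)" by simp
    then show ?thesis using s by (simp only: ennreal_mult' ennreal_numeral zero_le_numeral)
  qed
  finally show ?thesis .
qed

section \<open>Tensor products in the plane\<close>

text \<open>Allowing either order of the coordinates lets one choose which coordinate is integrated first.\<close>

lemma nn_integral_real_2:
  fixes f :: "real ^ 2 \<Rightarrow> ennreal" and i j :: 2
  assumes [measurable]: "f \<in> borel_measurable borel" and ij: "i \<noteq> j"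
  shows "(\<integral>\<^sup>+ z. f z \<partial>lborel) = (\<integral>\<^sup>+ x. \<integral>\<^sup>+ y. f (x *\<^sub>R axis i 1 + y *\<^sub>R axis j 1) \<partial>lborel \<partial>lborel)"
proof -
  let ?v = "\<lambda>p :: real \<times> real. fst p *\<^sub>R axis i 1 + snd p *\<^sub>R axis j (1 :: real) :: real ^ 2"
  have U: "(UNIV :: 2 set) = {i, j}" using ij by (auto simp: UNIV_2) (metis exhaust_2)+
  have ax: "axis i (1 :: real) $ j = 0" "axis j (1 :: real) $ i = 0" "axis i (1 :: real) $ i = 1" "axis j (1 :: real) $ j = 1"
    using ij by (auto simp: axis_def)
  have "lborel = distr (lborel \<Otimes>\<^sub>M lborel) borel ?v"
  proof (rule lborel_eqI)
    fix l u :: "real ^ 2"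
    assume lu: "\<And>b. b \<in> Basis \<Longrightarrow> l \<bullet> b \<le> u \<bullet> b"
    have "l $ k \<le> u $ k" for k
      using lu[of "axis k 1"] by (simp add: inner_axis axis_in_Basis_iff)
    then have lu': "l $ i \<le> u $ i" "l $ j \<le> u $ j" by auto
    have "?v -` box l u \<inter> space (lborel \<Otimes>\<^sub>M lborel) = {l $ i<..<u $ i} \<times> {l $ j<..<u $ j}"
    proof -
      have "z \<in> box l u \<longleftrightarrow> (\<forall>k\<in>{i, j}. l $ k < z $ k \<and> z $ k < u $ k)" for z
        unfolding U[symmetric] by (simp add: mem_box_cart)
      then have "?v p \<in> box l u \<longleftrightarrow> fst p \<in> {l $ i<..<u $ i} \<and> snd p \<in> {l $ j<..<u $ j}" for p
        by (simp only: ball_simps vector_add_component vector_scaleR_component ax real_scaleR_def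
          mult_1_right mult_zero_right add_0_left add_0_right greaterThanLessThan_iff simp_thms)
      then show ?thesis 
        unfolding vimage_def space_pair_measure space_lborel space_borel
        by (simp only: set_eq_iff mem_Times_iff mem_Collect_eq Int_iff UNIV_I simp_thms)
    qed
    then have "emeasure (distr (lborel \<Otimes>\<^sub>M lborel) borel ?v) (box l u)
        = emeasure (lborel \<Otimes>\<^sub>M lborel) ({l $ i<..<u $ i} \<times> {l $ j<..<u $ j})"
      by (subst emeasure_distr) auto
    also have "\<dots> = ennreal (u $ i - l $ i) * ennreal (u $ j - l $ j)"
      using lu' by (subst lborel.emeasure_pair_measure_Times) auto
    also have "\<dots> = ennreal (\<Prod>b\<in>Basis. (u - l) \<bullet> b)"
    proof -
      have B: "(Basis :: (real ^ 2) set) = {axis i 1, axis j 1}"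
        by (auto simp: Basis_vec_def U)
      have neq: "axis i (1 :: real) \<noteq> axis j 1" using ij by (simp add: axis_eq_axis)
      have "(\<Prod>b\<in>Basis. (u - l) \<bullet> b) = (u $ i - l $ i) * (u $ j - l $ j)"
        unfolding B using neq by (simp add: inner_axis)
      then show ?thesis using lu' by (simp add: ennreal_mult)
    qed
    finally show "emeasure (distr (lborel \<Otimes>\<^sub>M lborel) borel ?v) (box l u) = ennreal (\<Prod>b\<in>Basis. (u - l) \<bullet> b)" .
  qed simp
  then have "(\<integral>\<^sup>+ z. f z \<partial>lborel) = (\<integral>\<^sup>+ z. f z \<partial>distr (lborel \<Otimes>\<^sub>M lborel) borel ?v)"
    by (rule arg_cong[where f = "\<lambda>M. \<integral>\<^sup>+ z. f z \<partial>M"])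
  also have "\<dots> = (\<integral>\<^sup>+ p. f (?v p) \<partial>(lborel \<Otimes>\<^sub>M lborel))"
    by (rule nn_integral_distr) simp_all
  also have "\<dots> = (\<integral>\<^sup>+ x. \<integral>\<^sup>+ y. f (x *\<^sub>R axis i 1 + y *\<^sub>R axis j 1) \<partial>lborel \<partial>lborel)"
    by (subst lborel.nn_integral_fst[symmetric]) simp_all
  finally show ?thesis .
qed

text \<open>The part of the planar energy in which only coordinate \<open>i\<close> changes in the increment. The integral over
  \<open>y $ j\<close> is that of a Cauchy density of width \<open>|x $ i - y $ i|\<close> and yields \<open>\<pi>\<close> over that
  width, which is the power missing from the one-dimensional kernel of order \<open>s\<close>.\<close>

lemma tensor_increment_in_one_direction_le:
  fixes a :: "real \<Rightarrow> real" and i j :: 2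
  assumes [measurable]: "a \<in> borel_measurable borel" and ij: "i \<noteq> j"
  shows "(\<integral>\<^sup>+ x. \<integral>\<^sup>+ y. ennreal ((a (x $ j))\<^sup>2) * (ennreal ((a (x $ i) - a (y $ i))\<^sup>2 * \<bar>x $ i - y $ i\<bar> powr (- 2 * s)) *
        ennreal (1 / ((x $ i - y $ i)\<^sup>2 + (x $ j - y $ j)\<^sup>2))) \<partial>(lborel :: (real ^ 2) measure) \<partial>(lborel :: (real ^ 2) measure))
    \<le> ennreal pi * ((\<integral>\<^sup>+ t. ennreal ((a t)\<^sup>2) \<partial>lborel) * gagliardo_energy s a)"
proof -
  have ax: "axis i (1 :: real) $ j = 0" "axis j (1 :: real) $ i = 0" "axis i (1 :: real) $ i = 1" "axis j (1 :: real) $ j = 1"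
    using ij by (auto simp: axis_def)
  have [measurable]: "(\<lambda>z :: real ^ 2. z $ k) \<in> borel_measurable borel" for k
    by (intro borel_measurable_continuous_onI continuous_intros)
  define D where "D x y = ennreal ((a x - a y)\<^sup>2 * \<bar>x - y\<bar> powr (- 2 * s))" for x y
  have D_meas [measurable]: "case_prod D \<in> borel_measurable (borel \<Otimes>\<^sub>M borel)"
    unfolding D_def by measurable
  have inner: "(\<integral>\<^sup>+ y. D (x $ i) (y $ i) * ennreal (1 / ((x $ i - y $ i)\<^sup>2 + (x $ j - y $ j)\<^sup>2)) \<partial>(lborel :: (real ^ 2) measure))
      \<le> ennreal pi * (\<integral>\<^sup>+ y. ennreal ((a (x $ i) - a y)\<^sup>2 / \<bar>x $ i - y\<bar> powr (1 + 2 * s)) \<partial>lborel)" for x :: "real ^ 2"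
  proof -
    have "(\<integral>\<^sup>+ y. D (x $ i) (y $ i) * ennreal (1 / ((x $ i - y $ i)\<^sup>2 + (x $ j - y $ j)\<^sup>2)) \<partial>(lborel :: (real ^ 2) measure))
      = (\<integral>\<^sup>+ y. \<integral>\<^sup>+ t. D (x $ i) y * ennreal (1 / ((x $ i - y)\<^sup>2 + (x $ j - t)\<^sup>2)) \<partial>lborel \<partial>lborel)"
      by (subst nn_integral_real_2[OF _ ij]) (simp_all add: ax)
    also have "\<dots> \<le> (\<integral>\<^sup>+ y. ennreal pi * ennreal ((a (x $ i) - a y)\<^sup>2 / \<bar>x $ i - y\<bar> powr (1 + 2 * s)) \<partial>lborel)"
    proof (rule nn_integral_mono)
      fix y
      show "(\<integral>\<^sup>+ t. D (x $ i) y * ennreal (1 / ((x $ i - y)\<^sup>2 + (x $ j - t)\<^sup>2)) \<partial>lborel)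
        \<le> ennreal pi * ennreal ((a (x $ i) - a y)\<^sup>2 / \<bar>x $ i - y\<bar> powr (1 + 2 * s))"
      proof (cases "x $ i = y")
        case False
        let ?A = "\<bar>x $ i - y\<bar>"
        have A: "?A > 0" using False by simp
        have "(\<integral>\<^sup>+ t. D (x $ i) y * ennreal (1 / ((x $ i - y)\<^sup>2 + (x $ j - t)\<^sup>2)) \<partial>lborel)
            = D (x $ i) y * (\<integral>\<^sup>+ t. ennreal (1 / (?A\<^sup>2 + (x $ j - t)\<^sup>2)) \<partial>lborel)"
          by (simp add: nn_integral_cmult)
        also have "\<dots> \<le> D (x $ i) y * ennreal (pi / ?A)"
          by (intro mult_left_mono nn_integral_cauchy_kernel_le A) simp
        also have "\<dots> = ennreal ((a (x $ i) - a y)\<^sup>2 * ?A powr (- 2 * s) * (pi / ?A))"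
          unfolding D_def by (rule ennreal_mult[symmetric]) auto
        also have "(a (x $ i) - a y)\<^sup>2 * ?A powr (- 2 * s) * (pi / ?A) = pi * ((a (x $ i) - a y)\<^sup>2 / ?A powr (1 + 2 * s))"
          using A by (simp add: powr_add powr_minus divide_inverse mult_ac)
        also have "ennreal \<dots> = ennreal pi * ennreal ((a (x $ i) - a y)\<^sup>2 / ?A powr (1 + 2 * s))"
          by (rule ennreal_mult) auto
        finally show ?thesis .
      qed (simp add: D_def)
    qed
    also have "\<dots> = ennreal pi * (\<integral>\<^sup>+ y. ennreal ((a (x $ i) - a y)\<^sup>2 / \<bar>x $ i - y\<bar> powr (1 + 2 * s)) \<partial>lborel)"
      by (rule nn_integral_cmult) simp
    finally show ?thesis .
  qed
  define e where "e x = (\<integral>\<^sup>+ y. ennreal ((a x - a y)\<^sup>2 / \<bar>x - y\<bar> powr (1 + 2 * s)) \<partial>lborel)" for x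
  have [measurable]: "e \<in> borel_measurable borel" unfolding e_def[abs_def] by measurable
  have E: "(\<integral>\<^sup>+ x. e x \<partial>lborel) = gagliardo_energy s a"
    unfolding e_def by (subst gagliardo_energy_iterated) simp_all
  have "(\<integral>\<^sup>+ x. \<integral>\<^sup>+ y. ennreal ((a (x $ j))\<^sup>2) * (D (x $ i) (y $ i) *
        ennreal (1 / ((x $ i - y $ i)\<^sup>2 + (x $ j - y $ j)\<^sup>2))) \<partial>(lborel :: (real ^ 2) measure) \<partial>(lborel :: (real ^ 2) measure))
      \<le> (\<integral>\<^sup>+ x. ennreal ((a (x $ j))\<^sup>2) * (ennreal pi * e (x $ i)) \<partial>(lborel :: (real ^ 2) measure))"
  proof (rule nn_integral_mono)
    fix x :: "real ^ 2"
    have "(\<integral>\<^sup>+ y. ennreal ((a (x $ j))\<^sup>2) * (D (x $ i) (y $ i) *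
        ennreal (1 / ((x $ i - y $ i)\<^sup>2 + (x $ j - y $ j)\<^sup>2))) \<partial>(lborel :: (real ^ 2) measure))
      = ennreal ((a (x $ j))\<^sup>2) * (\<integral>\<^sup>+ y. D (x $ i) (y $ i) *
        ennreal (1 / ((x $ i - y $ i)\<^sup>2 + (x $ j - y $ j)\<^sup>2)) \<partial>(lborel :: (real ^ 2) measure))"
      by (rule nn_integral_cmult) simp
    also have "\<dots> \<le> ennreal ((a (x $ j))\<^sup>2) * (ennreal pi * e (x $ i))"
      unfolding e_def by (rule mult_left_mono[OF inner]) simp
    finally show "(\<integral>\<^sup>+ y. ennreal ((a (x $ j))\<^sup>2) * (D (x $ i) (y $ i) *
        ennreal (1 / ((x $ i - y $ i)\<^sup>2 + (x $ j - y $ j)\<^sup>2))) \<partial>(lborel :: (real ^ 2) measure)) \<le> \<dots>" .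
  qed
  also have "\<dots> = (\<integral>\<^sup>+ r. \<integral>\<^sup>+ t. ennreal ((a t)\<^sup>2) * (ennreal pi * e r) \<partial>lborel \<partial>lborel)"
    by (subst nn_integral_real_2[OF _ ij]) (simp_all add: ax)
  also have "\<dots> = ennreal pi * ((\<integral>\<^sup>+ t. ennreal ((a t)\<^sup>2) \<partial>lborel) * gagliardo_energy s a)"
    by (simp add: nn_integral_multc nn_integral_cmult E mult_ac)
  finally show ?thesis unfolding D_def .
qed

lemma power2_norm_real_2: "(norm (z :: real ^ 2))\<^sup>2 = (z $ 1)\<^sup>2 + (z $ 2)\<^sup>2"
  unfolding power2_norm_eq_inner inner_vec_def sum_2 by (simp add: power2_eq_square)

text \<open>Replacing \<open>norm z\<close> by the smaller \<open>|z $ i|\<close> in the factor of exponent \<open>2 s\<close> leaves a Cauchy density in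
  the other coordinate. As \<open>0 powr p = 0\<close>, the right-hand side vanishes when
  \<open>z $ i = 0\<close>, so the numerator has to vanish as well.\<close>

lemma fractional_kernel_le:
  fixes z :: "real ^ 2"
  assumes s: "s > 0" and c: "c \<ge> 0" and c0: "z $ i = 0 \<Longrightarrow> c = 0"
  shows "c / norm z powr (2 + 2 * s) \<le> c * \<bar>z $ i\<bar> powr (- 2 * s) * (1 / ((z $ 1)\<^sup>2 + (z $ 2)\<^sup>2))"
proof (cases "z $ i = 0")
  case False
  then have p: "\<bar>z $ i\<bar> > 0" by simp
  have n: "norm z > 0" using component_le_norm_cart[of z i] p by linarith
  have "norm z powr (- 2 * s) \<le> \<bar>z $ i\<bar> powr (- 2 * s)"
    using s p component_le_norm_cart[of z i] by (intro powr_mono2') auto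
  then have "c * norm z powr (- 2 * s) * (1 / (norm z)\<^sup>2) \<le> c * \<bar>z $ i\<bar> powr (- 2 * s) * (1 / (norm z)\<^sup>2)"
    using c by (intro mult_right_mono mult_left_mono) auto
  moreover have "c / norm z powr (2 + 2 * s) = c * norm z powr (- 2 * s) * (1 / (norm z)\<^sup>2)"
    using n by (simp add: powr_add powr_minus divide_inverse mult_ac)
  ultimately show ?thesis by (simp add: power2_norm_real_2)
qed (simp add: c0)

text \<open>The increment of \<open>a(z\<^sub>1) a(z\<^sub>2)\<close> splits into one increment in each direction. The second one
  carries the factor \<open>a (y $ 1)\<close> at the point \<open>y\<close>; exchanging the roles of \<open>x\<close> and \<open>y\<close> brings it to
  the same form as the first.\<close>

lemma gagliardo_energy_tensor_le:
  fixes a :: "real \<Rightarrow> real"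
  assumes [measurable]: "a \<in> borel_measurable borel" and s: "s > 0"
  shows "gagliardo_energy s (\<lambda>z :: real ^ 2. a (z $ 1) * a (z $ 2))
    \<le> ennreal (4 * pi) * ((\<integral>\<^sup>+ t. ennreal ((a t)\<^sup>2) \<partial>lborel) * gagliardo_energy s a)"
proof -
  have [measurable]: "(\<lambda>z :: real ^ 2. z $ k) \<in> borel_measurable borel" for k
    by (intro borel_measurable_continuous_onI continuous_intros)
  let ?K = "\<lambda>x y :: real ^ 2. ennreal (1 / ((x $ 1 - y $ 1)\<^sup>2 + (x $ 2 - y $ 2)\<^sup>2))"
  let ?G = "\<lambda>i j (x :: real ^ 2) y. ennreal ((a (x $ j))\<^sup>2) *
    (ennreal ((a (x $ i) - a (y $ i))\<^sup>2 * \<bar>x $ i - y $ i\<bar> powr (- 2 * s)) * ?K x y)"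
  let ?P = "ennreal pi * ((\<integral>\<^sup>+ t. ennreal ((a t)\<^sup>2) \<partial>lborel) * gagliardo_energy s a)"
  let ?u = "\<lambda>z :: real ^ 2. a (z $ 1) * a (z $ 2)"
  have G12: "(\<integral>\<^sup>+ x. \<integral>\<^sup>+ y. ?G 1 2 x y \<partial>lborel \<partial>lborel) \<le> ?P"
    using tensor_increment_in_one_direction_le[of a 1 2 s] by simp
  have G21: "(\<integral>\<^sup>+ x. \<integral>\<^sup>+ y. ?G 2 1 x y \<partial>lborel \<partial>lborel) \<le> ?P"
    using tensor_increment_in_one_direction_le[of a 2 1 s] by (simp add: add.commute)
  have le: "ennreal ((?u x - ?u y)\<^sup>2 / norm (x - y) powr (2 + 2 * s)) \<le> 2 * ?G 1 2 x y + 2 * ?G 2 1 y x" for x y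
  proof -
    define z where "z = x - y"
    define c1 where "c1 = (a (x $ 1) - a (y $ 1))\<^sup>2"
    define c2 where "c2 = (a (y $ 2) - a (x $ 2))\<^sup>2"
    define q where "q = 1 / ((z $ 1)\<^sup>2 + (z $ 2)\<^sup>2)"
    have q: "q \<ge> 0" by (simp add: q_def)
    have k1: "c1 / norm z powr (2 + 2 * s) \<le> c1 * \<bar>z $ 1\<bar> powr (- 2 * s) * q"
      unfolding q_def by (rule fractional_kernel_le[OF s]) (auto simp: c1_def z_def)
    have k2: "c2 / norm z powr (2 + 2 * s) \<le> c2 * \<bar>z $ 2\<bar> powr (- 2 * s) * q"
      unfolding q_def by (rule fractional_kernel_le[OF s]) (auto simp: c2_def z_def)
    have "(?u x - ?u y)\<^sup>2 = (a (x $ 2) * (a (x $ 1) - a (y $ 1)) + a (y $ 1) * (a (x $ 2) - a (y $ 2)))\<^sup>2"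
      by (simp add: algebra_simps)
    also have "\<dots> \<le> 2 * (a (x $ 2) * (a (x $ 1) - a (y $ 1)))\<^sup>2 + 2 * (a (y $ 1) * (a (x $ 2) - a (y $ 2)))\<^sup>2"
      by (rule square_add_le)
    also have "\<dots> = 2 * ((a (x $ 2))\<^sup>2 * c1) + 2 * ((a (y $ 1))\<^sup>2 * c2)"
      by (simp add: c1_def c2_def power_mult_distrib power2_commute)
    finally have "(?u x - ?u y)\<^sup>2 / norm z powr (2 + 2 * s)
        \<le> (2 * ((a (x $ 2))\<^sup>2 * c1) + 2 * ((a (y $ 1))\<^sup>2 * c2)) / norm z powr (2 + 2 * s)"
      by (rule divide_right_mono) simp
    also have "\<dots> = 2 * ((a (x $ 2))\<^sup>2 * (c1 / norm z powr (2 + 2 * s))) + 2 * ((a (y $ 1))\<^sup>2 * (c2 / norm z powr (2 + 2 * s)))"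
      by (simp add: add_divide_distrib)
    also have "\<dots> \<le> 2 * ((a (x $ 2))\<^sup>2 * (c1 * \<bar>z $ 1\<bar> powr (- 2 * s) * q)) + 2 * ((a (y $ 1))\<^sup>2 * (c2 * \<bar>z $ 2\<bar> powr (- 2 * s) * q))"
      by (intro add_mono mult_left_mono k1 k2) auto
    finally have "ennreal ((?u x - ?u y)\<^sup>2 / norm z powr (2 + 2 * s)) \<le> ennreal \<dots>"
      by (rule ennreal_leI)
    also have "\<dots> = 2 * ennreal ((a (x $ 2))\<^sup>2 * (c1 * \<bar>z $ 1\<bar> powr (- 2 * s) * q)) + 2 * ennreal ((a (y $ 1))\<^sup>2 * (c2 * \<bar>z $ 2\<bar> powr (- 2 * s) * q))"
      by (rule ennreal_double_add) (use q in \<open>auto simp: c1_def c2_def intro!: mult_nonneg_nonneg\<close>)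
    also have "ennreal ((a (x $ 2))\<^sup>2 * (c1 * \<bar>z $ 1\<bar> powr (- 2 * s) * q)) = ?G 1 2 x y"
      using q by (subst ennreal_mult, simp, simp add: c1_def, subst ennreal_mult)
        (simp_all add: c1_def q_def z_def)
    also have "ennreal ((a (y $ 1))\<^sup>2 * (c2 * \<bar>z $ 2\<bar> powr (- 2 * s) * q)) = ?G 2 1 y x"
      using q by (subst ennreal_mult, simp, simp add: c2_def, subst ennreal_mult)
        (simp_all add: c2_def q_def z_def power2_commute abs_minus_commute)
    finally show ?thesis unfolding z_def .
  qed
  have "gagliardo_energy s ?u = (\<integral>\<^sup>+ x. \<integral>\<^sup>+ y. ennreal ((?u x - ?u y)\<^sup>2 / norm (x - y) powr (2 + 2 * s)) \<partial>lborel \<partial>lborel)"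
    by (subst gagliardo_energy_iterated) simp_all
  also have "\<dots> \<le> (\<integral>\<^sup>+ x. \<integral>\<^sup>+ y. 2 * ?G 1 2 x y + 2 * ?G 2 1 y x \<partial>lborel \<partial>lborel)"
    by (intro nn_integral_mono le)
  also have "\<dots> = 2 * (\<integral>\<^sup>+ x. \<integral>\<^sup>+ y. ?G 1 2 x y \<partial>lborel \<partial>lborel) + 2 * (\<integral>\<^sup>+ x. \<integral>\<^sup>+ y. ?G 2 1 y x \<partial>lborel \<partial>lborel)"
    by (simp add: nn_integral_add nn_integral_cmult)
  also have "(\<integral>\<^sup>+ x. \<integral>\<^sup>+ y. ?G 2 1 y x \<partial>lborel \<partial>lborel) = (\<integral>\<^sup>+ y. \<integral>\<^sup>+ x. ?G 2 1 y x \<partial>lborel \<partial>lborel)"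
    by (rule lborel_pair.Fubini') simp
  also have "2 * (\<integral>\<^sup>+ x. \<integral>\<^sup>+ y. ?G 1 2 x y \<partial>lborel \<partial>lborel) + 2 * (\<integral>\<^sup>+ y. \<integral>\<^sup>+ x. ?G 2 1 y x \<partial>lborel \<partial>lborel) \<le> 2 * ?P + 2 * ?P"
    by (intro add_mono mult_left_mono G12 G21) simp_all
  also have "\<dots> = ennreal (4 * pi) * ((\<integral>\<^sup>+ t. ennreal ((a t)\<^sup>2) \<partial>lborel) * gagliardo_energy s a)"
    by (simp add: ennreal_mult mult.assoc flip: distrib_right)
  finally show ?thesis .
qed

section \<open>The comb domains\<close>

definition comb :: "nat \<Rightarrow> (real ^ 2) set" where
  "comb m = {z. 0 < z $ 1 \<and> z $ 1 < real m \<and> 0 < z $ 2 \<and> z $ 2 < real m \<and> (z $ 1 \<notin> \<int> \<or> z $ 2 < 1)}"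

lemma open_comb: "open (comb m)"
proof -
  have "open {z :: real ^ 2. z $ 1 \<notin> \<int>}"
  proof -
    have "open ((\<lambda>z :: real ^ 2. z $ 1) -` (- \<int>))"
      by (intro open_vimage continuous_intros) (simp add: open_Compl)
    then show ?thesis by (simp add: vimage_def)
  qed
  then show ?thesis unfolding comb_def
    by (intro open_Collect_conj open_Collect_disj open_Collect_less continuous_intros)
qed

lemma bounded_comb: "bounded (comb m)"
proof (rule bounded_subset[OF bounded_cbox])
  show "comb m \<subseteq> cbox 0 (\<chi> i. real m)" by (auto simp: comb_def mem_box_cart forall_2)
qed

lemma comb_nonempty:
  assumes "m \<ge> 1"
  shows "comb m \<noteq> {}"
proof -
  have "(\<chi> i. 1 / 2) \<in> comb m" using assms by (simp add: comb_def)
  then show ?thesis by blast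
qed

text \<open>Moving a point straight towards height \<open>1 / 2\<close> stays in the comb, because slits are vertical and
  begin above that height. The resulting horizontal segment is then contracted to a point.\<close>

lemma simply_connected_comb:
  assumes m: "m \<ge> 1"
  shows "simply_connected (comb m)"
proof (rule contractible_imp_simply_connected)
  let ?f = "\<lambda>z :: real ^ 2. z $ 1 *\<^sub>R axis 1 1 + (1 / 2) *\<^sub>R axis 2 (1 :: real) :: real ^ 2"
  let ?c = "(1 / 2) *\<^sub>R axis 1 1 + (1 / 2) *\<^sub>R axis 2 (1 :: real) :: real ^ 2"
  have ax: "axis 1 (1 :: real) $ (2 :: 2) = 0" "axis 2 (1 :: real) $ (1 :: 2) = 0"
    "axis 1 (1 :: real) $ (1 :: 2) = 1" "axis 2 (1 :: real) $ (2 :: 2) = 1"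
    by (auto simp: axis_def)
  have mix: "(1 - t) * p + t * q \<in> {0<..<r}" if "p \<in> {0<..<r}" "q \<in> {0<..<r}" "0 \<le> t" "t \<le> 1" for p q r t :: real
    using convexD_alt[OF convex_real_interval(8) that] by simp
  have half: "(1 / 2 :: real) \<in> {0<..<real m}" using m by auto
  have "homotopic_with_canon (\<lambda>x. True) (comb m) (comb m) id ?f"
  proof (rule homotopic_with_linear)
    show "closed_segment (id z) (?f z) \<subseteq> comb m" if z: "z \<in> comb m" for z
    proof
      fix w assume "w \<in> closed_segment (id z) (?f z)"
      then obtain t where t: "0 \<le> t" "t \<le> 1" and w: "w = (1 - t) *\<^sub>R z + t *\<^sub>R ?f z"
        by (auto simp: in_segment)
      have w1: "w $ 1 = z $ 1" by (simp add: w ax algebra_simps)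
      have w2: "w $ 2 = (1 - t) * z $ 2 + t * (1 / 2)" by (simp add: w ax)
      have "w $ 2 \<in> {0<..<real m}" unfolding w2 by (rule mix[OF _ half t]) (use z in \<open>simp add: comb_def\<close>)
      moreover have "w $ 2 < 1" if "z $ 2 < 1"
        using mix[of "z $ 2" 1 "1 / 2" t] t z that unfolding w2 by (simp add: comb_def)
      ultimately show "w \<in> comb m" using z by (auto simp: comb_def w1)
    qed
  qed (intro continuous_intros | simp)+
  moreover have "homotopic_with_canon (\<lambda>x. True) (comb m) (comb m) ?f (\<lambda>_. ?c)"
  proof (rule homotopic_with_linear)
    show "closed_segment (?f z) ?c \<subseteq> comb m" if z: "z \<in> comb m" for z
    proof
      fix w assume "w \<in> closed_segment (?f z) ?c"
      then obtain t where t: "0 \<le> t" "t \<le> 1" and w: "w = (1 - t) *\<^sub>R ?f z + t *\<^sub>R ?c"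
        by (auto simp: in_segment)
      have w2: "w $ 2 = 1 / 2" by (simp add: w ax field_simps)
      have w1: "w $ 1 = (1 - t) * z $ 1 + t * (1 / 2)" by (simp add: w ax)
      have "w $ 1 \<in> {0<..<real m}" unfolding w1 by (rule mix[OF _ half t]) (use z in \<open>simp add: comb_def\<close>)
      then show "w \<in> comb m" using half by (auto simp: comb_def w2)
    qed
  qed (intro continuous_intros | simp)+
  ultimately show "contractible (comb m)"
    unfolding contractible_def using homotopic_with_trans by blast
qed

lemma inradius_pos:
  assumes "open \<Omega>" "\<Omega> \<noteq> {}"
  shows "0 < inradius \<Omega>"
proof -
  obtain x where x: "x \<in> \<Omega>" using assms by blast
  then obtain \<rho> where \<rho>: "\<rho> > 0" "ball x \<rho> \<subseteq> \<Omega>" using assms open_contains_ball by blast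
  have "0 < ennreal \<rho>" using \<rho> by simp
  also have "\<dots> \<le> inradius \<Omega>" unfolding inradius_def by (rule SUP_upper) (use x \<rho> in auto)
  finally show ?thesis .
qed

text \<open>Otherwise a ball of radius larger than \<open>2\<close> would fit. Its lower half forces the height of the centre
  above \<open>1\<close>, and at that height the ball reaches the next integer abscissa, hence a slit.\<close>

lemma inradius_comb_le: "inradius (comb m) \<le> ennreal 2"
  unfolding inradius_def
proof (rule SUP_least, clarify, rule ennreal_leI, rule ccontr)
  fix \<rho> z
  assume sub: "ball z \<rho> \<subseteq> comb m" and "\<not> \<rho> \<le> 2"
  then have \<rho>: "\<rho> > 2" by simp
  have "z - axis 2 1 \<in> ball z \<rho>" using \<rho> by (simp add: dist_norm norm_axis_1)
  then have "z - axis 2 1 \<in> comb m" using sub by blast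
  then have "z $ 2 > 1" by (simp add: comb_def axis_def)
  \<comment> \<open>the horizontal distance to the next integer on the right\<close>
  define d where "d = real_of_int \<lceil>z $ 1\<rceil> - z $ 1"
  have d: "0 \<le> d" "d \<le> 1" unfolding d_def by linarith+
  have "z + d *\<^sub>R axis 1 1 \<in> ball z \<rho>" using \<rho> d by (simp add: dist_norm norm_axis_1)
  then have "z + d *\<^sub>R axis 1 1 \<in> comb m" using sub by blast
  moreover have "(z + d *\<^sub>R axis 1 1) $ 1 \<in> \<int>" by (simp add: axis_def d_def)
  ultimately have "(z + d *\<^sub>R axis 1 1) $ 2 < 1" unfolding comb_def by blast
  then show False using \<open>z $ 2 > 1\<close> by (simp add: axis_def)
qed

section \<open>Small first eigenvalues of the combs\<close>

text \<open>A test function approximates itself, so it is admissible in the infimum.\<close>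

lemma lambda1_le_test_quotient:
  fixes u :: "'a::euclidean_space \<Rightarrow> real"
  assumes u: "u \<in> test_functions \<Omega>" and e: "gagliardo_energy s u \<le> ennreal e" "e \<ge> 0"
    and B: "(\<integral>\<^sup>+ x. ennreal ((u x)\<^sup>2) \<partial>lborel) = ennreal B" "B > 0"
  shows "lambda1 s \<Omega> \<le> ennreal (e / B)"
proof -
  have Ck: "Ck k u" for k using u by (simp add: test_functions_def)
  have [measurable]: "u \<in> borel_measurable borel" by (rule Ck_imp_borel_measurable[OF Ck])
  have off: "u x = 0" if "x \<notin> \<Omega>" for x
  proof (rule ccontr)
    assume "u x \<noteq> 0"
    then have "x \<in> closure {x. u x \<noteq> 0}" by (intro subsetD[OF closure_subset]) simp
    moreover have "closure {x. u x \<noteq> 0} \<subseteq> \<Omega>" using u by (simp add: test_functions_def)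
    ultimately show False using that by blast
  qed
  have int: "integrable lborel (\<lambda>x. \<bar>u x\<bar>\<^sup>2)"
    by (rule integrableI_nonneg) (use B in auto)
  have fin: "gagliardo_energy s u < \<infinity>" using e(1) by (rule le_less_trans) simp
  have "Ws2_norm s (\<lambda>x. u x - u x) = 0"
    by (simp add: Ws2_norm_def L2_norm_on_def gagliardo_seminorm_def gagliardo_energy_const set_lebesgue_integral_def)
  then have mem: "u \<in> Ws2_0 s \<Omega>"
    using int fin u by (auto simp: Ws2_0_def Ws2_def intro!: bexI[of _ u])
  have nz: "\<not> (AE x in lborel. u x = 0)"
  proof
    assume "AE x in lborel. u x = 0"
    then have "(\<integral>\<^sup>+ x. ennreal ((u x)\<^sup>2) \<partial>lborel) = (\<integral>\<^sup>+ x. 0 \<partial>(lborel :: 'a measure))"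
      by (intro nn_integral_cong_AE) auto
    then show False using B by simp
  qed
  have "(LINT x:\<Omega>|lborel. \<bar>u x\<bar>\<^sup>2) = (LINT x|lborel. \<bar>u x\<bar>\<^sup>2)"
    unfolding set_lebesgue_integral_def by (intro Bochner_Integration.integral_cong) (auto simp: indicator_def off)
  also have "\<dots> = B"
    by (subst integral_eq_nn_integral) (use B in auto)
  finally have L2: "(L2_norm_on \<Omega> u)\<^sup>2 = B" using B(2) by (simp add: L2_norm_on_def)
  have "(gagliardo_seminorm s u)\<^sup>2 = enn2real (gagliardo_energy s u)"
    by (simp add: gagliardo_seminorm_def)
  also have "\<dots> \<le> enn2real (ennreal e)" by (rule enn2real_mono[OF e(1)]) simp
  finally have semi: "(gagliardo_seminorm s u)\<^sup>2 \<le> e" using e(2) by simp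
  have "lambda1 s \<Omega> \<le> ennreal ((gagliardo_seminorm s u)\<^sup>2 / (L2_norm_on \<Omega> u)\<^sup>2)"
    unfolding lambda1_def by (rule INF_lower) (use mem nz in simp)
  also have "\<dots> \<le> ennreal (e / B)"
    unfolding L2 using semi B(2) by (intro ennreal_leI divide_right_mono) auto
  finally show ?thesis .
qed

text \<open>The profile vanishes near the integers, so the product vanishes near the whole vertical lines that
  carry the slits and near the boundary of the square.\<close>

lemma tensor_in_test_functions_comb:
  assumes Ck: "\<And>k. Ck k a" and r: "r > 0" "\<And>i x. i \<le> m \<Longrightarrow> \<bar>x - real i\<bar> < r \<Longrightarrow> a x = 0"
    and supp: "\<And>x. x \<notin> {real m / 4..3 * real m / 4} \<Longrightarrow> a x = 0" and m: "m \<ge> 1"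
  shows "(\<lambda>z. a (z $ 1) * a (z $ 2)) \<in> test_functions (comb m)"
proof -
  let ?u = "\<lambda>z :: real ^ 2. a (z $ 1) * a (z $ 2)"
  let ?T = "cbox (\<chi> k. real m / 4) (\<chi> k. 3 * real m / 4) \<inter> (\<Inter>i\<in>{..m}. {z :: real ^ 2. r \<le> \<bar>z $ 1 - real i\<bar>})"
  have "closed ?T"
    by (intro closed_Int closed_cbox closed_INT ballI closed_Collect_le continuous_intros)
  moreover have "{z. ?u z \<noteq> 0} \<subseteq> ?T"
  proof
    fix z assume "z \<in> {z. ?u z \<noteq> 0}"
    then have nz: "a (z $ 1) \<noteq> 0" "a (z $ 2) \<noteq> 0" by auto
    then have "z $ 1 \<in> {real m / 4..3 * real m / 4}" "z $ 2 \<in> {real m / 4..3 * real m / 4}"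
      using supp by blast+
    moreover have "r \<le> \<bar>z $ 1 - real i\<bar>" if "i \<le> m" for i
      using r(2)[OF that, of "z $ 1"] nz by linarith
    ultimately show "z \<in> ?T" by (auto simp: mem_box_cart forall_2)
  qed
  ultimately have cl: "closure {z. ?u z \<noteq> 0} \<subseteq> ?T" by (rule closure_minimal[rotated])
  have "?T \<subseteq> comb m"
  proof
    fix z assume z: "z \<in> ?T"
    have "real m > 0" using m by simp
    then have box: "0 < z $ 1" "z $ 1 < real m" "0 < z $ 2" "z $ 2 < real m"
      using z by (auto simp: mem_box_cart forall_2)
    have "z $ 1 \<notin> \<int>"
    proof
      assume "z $ 1 \<in> \<int>"
      then obtain k :: int where k: "z $ 1 = of_int k" by (auto elim: Ints_cases)
      then have "z $ 1 = real (nat k)" "nat k \<le> m" using box by auto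
      moreover from this have "r \<le> \<bar>z $ 1 - real (nat k)\<bar>" using z by blast
      ultimately show False using r(1) by simp
    qed
    with box show "z \<in> comb m" by (simp add: comb_def)
  qed
  with cl have "closure {z. ?u z \<noteq> 0} \<subseteq> comb m" by (rule order_trans)
  moreover have "compact (closure {z. ?u z \<noteq> 0})"
    unfolding compact_eq_bounded_closed
    using bounded_subset[OF bounded_cbox order_trans[OF cl Int_lower1]] closed_closure by blast
  moreover have "Ck k ?u" for k
    by (intro Ck_mult Ck_compose_affine[OF Ck]) (rule bounded_linear_imp_has_derivative[OF bounded_linear_vec_nth])+
  ultimately show ?thesis unfolding test_functions_def by blast
qed

text \<open>With \<open>A\<close> the squared \<open>L\<^sup>2\<close> norm of the profile, the planar function has squared norm \<open>A\<^sup>2\<close>. Splitting at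
  distance \<open>R = m\<close> balances the two terms of the interpolation: the first is divided by
  \<open>A \<ge> m / 8\<close>, and both become multiples of \<open>m\<close> to the power \<open>- 2 s\<close>.\<close>

lemma lambda1_comb_le:
  "\<exists>C. \<forall>m\<ge>1. lambda1 s (comb m) \<le> ennreal (C * real m powr (- 2 * s))" if s: "0 < s" "s \<le> 1 / 2"
proof -
  have "2 * gagliardo_energy (1/2) bump + 2 < \<infinity>"
    using half_energy_bump_finite by (simp add: ennreal_mult_less_top)
  then obtain M where M: "M \<ge> 0" "2 * gagliardo_energy (1/2) bump + 2 = ennreal M"
    by (metis infinity_ennreal_def less_top_ennreal)
  show ?thesis
  proof (intro exI allI impI)
    fix m :: nat assume m: "m \<ge> 1"
    then have mpos: "real m > 0" by simp
    obtain a r where Ck: "\<And>k. Ck k a" and a1: "\<And>x. \<bar>a x\<bar> \<le> 1"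
      and r: "r > 0" "\<And>i x. i \<le> m \<Longrightarrow> \<bar>x - real i\<bar> < r \<Longrightarrow> a x = 0"
      and supp: "\<And>x. x \<notin> {real m / 4..3 * real m / 4} \<Longrightarrow> a x = 0"
      and E: "gagliardo_energy (1/2) a \<le> ennreal M"
      and low: "ennreal (real m / 8) \<le> (\<integral>\<^sup>+ x. ennreal ((a x)\<^sup>2) \<partial>lborel)"
      using exists_half_energy_test_profile[OF m] unfolding M(2) by blast
    have [measurable]: "a \<in> borel_measurable borel" by (rule Ck_imp_borel_measurable[OF Ck])
    have [measurable]: "(\<lambda>z :: real ^ 2. z $ k) \<in> borel_measurable borel" for k
      by (intro borel_measurable_continuous_onI continuous_intros)
    let ?N = "\<integral>\<^sup>+ x. ennreal ((a x)\<^sup>2) \<partial>lborel"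
    let ?u = "\<lambda>z :: real ^ 2. a (z $ 1) * a (z $ 2)"
    have "?N \<le> (\<integral>\<^sup>+ x. indicator {real m / 4..3 * real m / 4} x \<partial>lborel)"
      using a1 supp by (intro nn_integral_mono) (auto simp: indicator_def abs_square_le_1)
    also have "\<dots> < \<infinity>" by simp
    finally obtain A where A: "A \<ge> 0" "?N = ennreal A"
      by (metis infinity_ennreal_def less_top_ennreal)
    have Am: "real m / 8 \<le> A" using low A by simp
    then have Apos: "A > 0" using mpos by linarith
    let ?e = "real m powr (1 - 2 * s) * M + 4 / s * real m powr (- 2 * s) * A"
    have "gagliardo_energy s a \<le> ennreal (real m powr (1 - 2 * s)) * gagliardo_energy (1/2) a
        + ennreal (4 / s * real m powr (- 2 * s)) * ?N"
      by (rule half_energy_interpolation) (use s mpos in auto)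
    also have "\<dots> \<le> ennreal (real m powr (1 - 2 * s)) * ennreal M + ennreal (4 / s * real m powr (- 2 * s)) * ennreal A"
      unfolding A(2) by (intro add_mono mult_left_mono E) auto
    also have "\<dots> = ennreal ?e"
    proof -
      have "0 \<le> 4 / s * real m powr (- 2 * s)" using s by simp
      then show ?thesis using M(1) A(1) by (subst ennreal_plus) (auto simp only: ennreal_mult powr_ge_zero intro!: mult_nonneg_nonneg)
    qed
    finally have Ea: "gagliardo_energy s a \<le> ennreal ?e" .
    have e0: "?e \<ge> 0" using s M(1) A(1) by (intro add_nonneg_nonneg mult_nonneg_nonneg) auto
    have "gagliardo_energy s ?u \<le> ennreal (4 * pi) * (?N * gagliardo_energy s a)"
      by (rule gagliardo_energy_tensor_le) (use s in auto)
    also have "\<dots> \<le> ennreal (4 * pi) * (ennreal A * ennreal ?e)"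
      unfolding A(2) by (intro mult_left_mono Ea) auto
    also have "\<dots> = ennreal (4 * pi * (A * ?e))"
      using A(1) e0 by (simp only: ennreal_mult mult_nonneg_nonneg pi_ge_zero zero_le_numeral)
    finally have Eu: "gagliardo_energy s ?u \<le> ennreal (4 * pi * (A * ?e))" .
    have "(\<integral>\<^sup>+ z. ennreal ((?u z)\<^sup>2) \<partial>lborel) = (\<integral>\<^sup>+ x. \<integral>\<^sup>+ y. ennreal ((a x)\<^sup>2) * ennreal ((a y)\<^sup>2) \<partial>lborel \<partial>lborel)"
      by (subst nn_integral_real_2[of _ 1 2])
        (simp_all add: axis_def power_mult_distrib ennreal_mult)
    also have "\<dots> = ennreal (A * A)"
      using A by (simp add: nn_integral_cmult nn_integral_multc ennreal_mult)
    finally have Nu: "(\<integral>\<^sup>+ z. ennreal ((?u z)\<^sup>2) \<partial>lborel) = ennreal (A * A)" .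
    have "lambda1 s (comb m) \<le> ennreal (4 * pi * (A * ?e) / (A * A))"
      by (rule lambda1_le_test_quotient[OF tensor_in_test_functions_comb[OF Ck r supp m] Eu _ Nu])
        (use A e0 Apos in auto)
    also have "4 * pi * (A * ?e) / (A * A) \<le> 4 * pi * (8 * M + 4 / s) * real m powr (- 2 * s)"
    proof -
      have "M / A \<le> M / (real m / 8)"
        using M(1) Am mpos by (intro divide_left_mono) auto
      then have "real m powr (1 - 2 * s) * (M / A) \<le> real m powr (1 - 2 * s) * (M / (real m / 8))"
        by (rule mult_left_mono) simp
      also have "\<dots> = 8 * M * real m powr (- 2 * s)"
        using powr_add[of "real m" 1 "- 2 * s"] mpos by simp
      finally have "real m powr (1 - 2 * s) * (M / A) + 4 / s * real m powr (- 2 * s)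
          \<le> (8 * M + 4 / s) * real m powr (- 2 * s)"
        by (simp only: distrib_right add_le_cancel_right)
      moreover have "?e / A = real m powr (1 - 2 * s) * (M / A) + 4 / s * real m powr (- 2 * s)"
        using Apos by (simp add: add_divide_distrib)
      ultimately have "?e / A \<le> (8 * M + 4 / s) * real m powr (- 2 * s)" by (simp only:)
      then have "4 * pi * (?e / A) \<le> 4 * pi * ((8 * M + 4 / s) * real m powr (- 2 * s))"
        by (intro mult_left_mono) auto
      then show ?thesis using Apos by (simp add: mult.assoc)
    qed
    finally show "lambda1 s (comb m) \<le> ennreal (4 * pi * (8 * M + 4 / s) * real m powr (- 2 * s))"
      by (simp add: ennreal_leI)
  qed
qed

theorem theorem1p3:
  "\<exists>(Q :: nat \<Rightarrow> (real ^ 2) set) (C :: real).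
     C > 0 \<and>
     (\<forall>n. open (Q n) \<and> bounded (Q n) \<and> Q n \<noteq> {} \<and> simply_connected (Q n)) \<and>
     (\<forall>n. 0 < inradius (Q n) \<and> inradius (Q n) \<le> ennreal C) \<and>
     (\<forall>s::real. 0 < s \<and> s \<le> 1 / 2 \<longrightarrow> (\<lambda>n. lambda1 s (Q n)) \<longlonglongrightarrow> 0)"
proof (rule exI[of _ "\<lambda>n. comb (Suc n)"], rule exI[of _ 2], intro conjI allI impI)
  fix s :: real
  assume s: "0 < s \<and> s \<le> 1 / 2"
  then obtain C where C: "\<And>m. m \<ge> 1 \<Longrightarrow> lambda1 s (comb m) \<le> ennreal (C * real m powr (- 2 * s))"
    using lambda1_comb_le by blast
  have lim: "(\<lambda>n. C * real (Suc n) powr (- 2 * s)) \<longlonglongrightarrow> C * 0"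
    using s by (intro tendsto_intros tendsto_neg_powr filterlim_compose[OF filterlim_real_sequentially filterlim_Suc]) auto
  have upper: "(\<lambda>n. ennreal (C * real (Suc n) powr (- 2 * s))) \<longlonglongrightarrow> 0"
    using tendsto_ennrealI[OF lim] by simp
  show "(\<lambda>n. lambda1 s (comb (Suc n))) \<longlonglongrightarrow> 0"
    by (rule tendsto_sandwich[OF _ _ tendsto_const upper]) (use C in \<open>simp_all del: of_nat_Suc\<close>)
qed (use inradius_comb_le in \<open>auto intro!: inradius_pos simp: open_comb bounded_comb comb_nonempty simply_connected_comb\<close>)

end
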